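(* Let the game, the operator $\mathbb{F}$, the solution set $\mathrm{SOL}(\boldsymbol\Omega,\mathbb{F},G)$, and the iterates $(\boldsymbol x^k)_{k\in\mathbb{N}}$ with single-sample approximation $F_{\mathrm{SA}}$, stochastic error $\epsilon^k$, filtration $(\mathcal F^k)_{k\in\mathbb N}$ and step sizes $\gamma_k>0$ be as in the context. Let $\boldsymbol x^*\in \mathrm{SOL}(\boldsymbol\Omega,\mathbb{F},G)$ and suppose that: (i) for all $k\ge 0$, $\mathbb{E}[\epsilon^k\mid\mathcal F^k]=0$ almost surely; (ii) $\sum_{k=0}^\infty\gamma_k=\infty$, $\sum_{k=0}^\infty\gamma_k^2<\infty$, and $\sum_{k=0}^\infty\gamma_k^2\,\mathbb{E}[\|\epsilon^k\|^2\mid\mathcal F^k]<\infty$ almost surely; (iii) (restricted Lipschitz continuity) there is $\ell>0$ such that $\|\mathbb{F}(\boldsymbol x)-\mathbb{F}(\boldsymbol x^* )\|\le\ell\|\boldsymbol x-\boldsymbol x^*\|$ for all $\boldsymbol x\in\boldsymbol\Omega$; (iv) (restricted strict monotonicity) $\langle \mathbb{F}(\boldsymbol x)-\mathbb{F}(\boldsymbol x^* ),\boldsymbol x-\boldsymbol x^*\rangle>0$ for all $\boldsymbol x\in\boldsymbol\Omega$ with $\boldsymbol x\neq\boldsymbol x^*$. Then $(\boldsymbol x^k)_{k\in\mathbb{N}}$ converges almost surely to a variational stochastic Nash equilibrium (v-SNE) of the game, i.e. to an element of $\mathrm{SOL}(\boldsymbol\Omega,\mathbb{F},G)$.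
   Context: Game. Let $\mathcal I=\{1,\dots,N\}$ be a set of agents. Agent $i$ has decision variable $x_i\in\Omega_i\subseteq\mathbb{R}^{n_i}$; $n=\sum_i n_i$, $\boldsymbol x=\mathrm{col}(x_1,\dots,x_N)\in\boldsymbol\Omega=\Omega_1\times\dots\times\Omega_N\subseteq\mathbb{R}^n$, and $\boldsymbol x_{-i}=\mathrm{col}(\{x_j\}_{j\ne i})\in\boldsymbol\Omega_{-i}=\prod_{j\neq i}\Omega_j$. Here $\mathrm{col}$ denotes stacking into a column vector; $\langle\cdot,\cdot\rangle$ and $\|\cdot\|$ are the Euclidean inner product and norm. The cost of agent $i$ is $\mathbb{J}_i(x_i,\boldsymbol x_{-i})=\mathbb{E}[f_i(x_i,\boldsymbol x_{-i},\xi_i)]+g_i(x_i)$, where $\xi_i$ is an $\mathbb{R}^d$-valued random variable, $f_i:\mathbb{R}^n\times\mathbb{R}^d\to\mathbb{R}$ and $g_i:\mathbb{R}^{n_i}\to\mathbb{R}\cup\{+\infty\}$. The game is: each agent $i$ solves $\min_{x_i\in\Omega_i}\mathbb{J}_i(x_i,\boldsymbol x_{-i})$. Standing assumptions. For each $i$ and $\boldsymbol x_{-i}\in\boldsymbol\Omega_{-i}$, the expected-value function $x_i\mapsto\mathbb{E}[f_i(x_i,\boldsymbol x_{-i},\xi_i)]$ is convex and continuously differentiable. For each $i$, each $\boldsymbol x_{-i}\in\boldsymbol\Omega_{-i}$ and each value $\xi$, the function $f_i(\cdot,\boldsymbol x_{-i},\xi)$ is convex, Lipschitz continuous with constant $\ell_i(\boldsymbol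 x_{-i},\xi)$, and continuously differentiable; $f_i(x_i,\boldsymbol x_{-i},\cdot)$ is measurable, and $\ell_i(\boldsymbol x_{-i},\xi)$ is integrable in $\xi$ for each $\boldsymbol x_{-i}\in\boldsymbol\Omega_{-i}$. For each $i$, $g_i$ is lower semicontinuous and convex and $\mathrm{dom}(g_i)=\Omega_i$ is nonempty, compact and convex. Pseudogradient and v-SNE. $\mathbb{F}(\boldsymbol x)=\mathrm{col}\big((\mathbb{E}[\nabla_{x_i}f_i(x_i,\boldsymbol x_{-i},\xi_i)])_{i\in\mathcal I}\big)$ and $G(\boldsymbol x)=\partial g_1(x_1)\times\dots\times\partial g_N(x_N)$. $\mathrm{SOL}(\boldsymbol\Omega,\mathbb{F},G)$ is the set of $\boldsymbol x^*\in\boldsymbol\Omega$ such that $\langle\mathbb{F}(\boldsymbol x^* ),\boldsymbol x-\boldsymbol x^*\rangle+\sum_{i\in\mathcal I}\{g_i(x_i)-g_i(x_i^* )\}\ge0$ for all $\boldsymbol x\in\boldsymbol\Omega$; its elements are called variational stochastic Nash equilibria (v-SNE) of the game. Algorithm (distributed stochastic forward–backward). Start from $x_i^0\in\Omega_i$ for all $i$, and for $k\ge0$ and all $i\in\mathcal I$ set $$x_i^{k+1}=\mathrm{prox}_{\gamma_k g_i}\big[x_i^k-\gamma_k\hat F_i(\boldsymbol x^k,\boldsymbol\xi^k)\big],$$ where $\mathrm{prox}_{g}(v)=\mathrm{argmin}_u\{g(u)+\tfrac12\|u-v\|^2\}$, $(\gamma_k)_{k\in\mathbb N}$ are positive step sizes,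 and $\hat F_i$ is the $i$-th block of the approximation $\hat F=F_{\mathrm{SA}}$ with $$F_{\mathrm{SA}}(\boldsymbol x^k,\boldsymbol\xi^k)=\mathrm{col}\big(\nabla_{x_1}f_1(\boldsymbol x^k,\xi_1^k),\dots,\nabla_{x_N}f_N(\boldsymbol x^k,\xi_N^k)\big),$$ where $\boldsymbol\xi^k=\mathrm{col}(\xi_1^k,\dots,\xi_N^k)$, $k\ge0$, are i.i.d. samples of $\mathrm{col}(\xi_1,\dots,\xi_N)$. The stochastic error is $\epsilon^k=F_{\mathrm{SA}}(\boldsymbol x^k,\boldsymbol\xi^k)-\mathbb{F}(\boldsymbol x^k)$. $\mathcal F^k$ is the $\sigma$-algebra generated by $\boldsymbol x^0,\boldsymbol\xi^0,\dots,\boldsymbol\xi^{k-1}$ (so $\boldsymbol x^k$ is $\mathcal F^k$-measurable).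
   Formalization: The formal theorem additionally assumes that the pseudogradient F is (jointly) continuous on Ω; the stated smoothness in x_i for fixed x_{-i} does not give this, and without it the claim fails (iterates may converge to a point outside SOL). *)

theory Defs
  imports "HOL-Probability.Probability"
begin

text \<open>
  The agents are the elements of a finite type \<open>'i\<close>, the coordinates of
  \<open>\<real>\<^sup>n\<close> are the elements of a finite type \<open>'n\<close>, and \<open>own j\<close> is the agent who
  controls coordinate \<open>j\<close>.  So \<open>n\<^sub>i\<close> is the number of coordinates owned by agent \<open>i\<close>, and
  may differ from agent to agent.  The space \<open>\<real>\<close>\<open>\<^bsup>n\<^sub>i\<^esup>\<close> is identified, isometrically,
  with the subspace \<open>agent_space own i\<close> of \<open>real ^ 'n\<close>; the component \<open>x\<^sub>i\<close> of a profile
  \<open>x\<close> is \<open>block own i x\<close>, its \<open>x\<^sub>-\<^sub>i\<close> is \<open>x - block own i x\<close>, and the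
  profile \<open>(u, y)\<close> with own decision \<open>u\<close> and decisions \<open>y\<close> of the others is \<open>u + y\<close>.
\<close>

definition agent_space :: "('n::finite \<Rightarrow> 'i::finite) \<Rightarrow> 'i \<Rightarrow> (real ^ 'n) set" where
  "agent_space own i = {u. \<forall>j. own j \<noteq> i \<longrightarrow> u $ j = 0}"

definition block :: "('n::finite \<Rightarrow> 'i::finite) \<Rightarrow> 'i \<Rightarrow> real ^ 'n \<Rightarrow> real ^ 'n" where
  "block own i x = (\<chi> j. if own j = i then x $ j else 0)"

definition col :: "('n::finite \<Rightarrow> 'i::finite) \<Rightarrow> ('i \<Rightarrow> real ^ 'n) \<Rightarrow> real ^ 'n" where
  "col own v = (\<chi> j. v (own j) $ j)"

definition profiles ::
    "('n::finite \<Rightarrow> 'i::finite) \<Rightarrow> ('i \<Rightarrow> (real ^ 'n) set) \<Rightarrow> (real ^ 'n) set" where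
  "profiles own \<Omega> = {x. \<forall>i. block own i x \<in> \<Omega> i}"

definition opponent_profiles ::
    "('n::finite \<Rightarrow> 'i::finite) \<Rightarrow> ('i \<Rightarrow> (real ^ 'n) set) \<Rightarrow> 'i \<Rightarrow> (real ^ 'n) set" where
  "opponent_profiles own \<Omega> i =
     {y. block own i y = 0 \<and> (\<forall>j. j \<noteq> i \<longrightarrow> block own j y \<in> \<Omega> j)}"

text \<open>
  Differentiation of functions on a linear subspace \<open>E\<close> (below: \<open>agent_space own i\<close>).
  The gradient is the representing vector inside \<open>E\<close>, which is unique.
\<close>

definition has_gradient_on ::
    "'a::euclidean_space set \<Rightarrow> ('a \<Rightarrow> real) \<Rightarrow> 'a \<Rightarrow> 'a \<Rightarrow> bool" where
  "has_gradient_on E \<phi> D u \<longleftrightarrow>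
     D \<in> E \<and> (\<phi> has_derivative (\<lambda>h. D \<bullet> h)) (at u within E)"

definition gradient_on ::
    "'a::euclidean_space set \<Rightarrow> ('a \<Rightarrow> real) \<Rightarrow> 'a \<Rightarrow> 'a" where
  "gradient_on E \<phi> u = (THE D. has_gradient_on E \<phi> D u)"

definition C1_on :: "'a::euclidean_space set \<Rightarrow> ('a \<Rightarrow> real) \<Rightarrow> bool" where
  "C1_on E \<phi> \<longleftrightarrow>
     (\<exists>D. (\<forall>u\<in>E. has_gradient_on E \<phi> (D u) u) \<and> continuous_on E D)"

definition lsc_on :: "'a::topological_space set \<Rightarrow> ('a \<Rightarrow> ereal) \<Rightarrow> bool" where
  "lsc_on E g \<longleftrightarrow> (\<forall>u\<in>E. g u \<le> Liminf (at u within E) g)"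

definition ereal_convex_on :: "'a::real_vector set \<Rightarrow> ('a \<Rightarrow> ereal) \<Rightarrow> bool" where
  "ereal_convex_on E g \<longleftrightarrow> convex E \<and>
     (\<forall>u\<in>E. \<forall>v\<in>E. \<forall>s\<ge>0. \<forall>t\<ge>0. s + t = 1 \<longrightarrow>
        g (s *\<^sub>R u + t *\<^sub>R v) \<le> ereal s * g u + ereal t * g v)"

definition prox ::
    "'a::euclidean_space set \<Rightarrow> ('a \<Rightarrow> ereal) \<Rightarrow> 'a \<Rightarrow> 'a" where
  "prox E g v = arg_min (\<lambda>u. g u + ereal (1/2 * (norm (u - v))\<^sup>2)) (\<lambda>u. u \<in> E)"

text \<open>
  In the following, \<open>\<xi> \<omega> $ i\<close> is the value of agent \<open>i\<close>'s random vector, and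
  \<open>f i x z\<close> is the value of agent \<open>i\<close>'s cost at the profile \<open>x\<close> and the
  realization \<open>z\<close>.  The modulus \<open>\<l> i y z\<close> is only used at opponent profiles \<open>y\<close>.
  Convexity, Lipschitz continuity and differentiability in the own decision are required on the
  whole of \<open>\<real>\<close>\<open>\<^bsup>n\<^sub>i\<^esup>\<close>.  The integrability of \<open>f\<close> says that the expected
  cost is well defined.
\<close>

locale stochastic_game = prob_space M
  for M :: "'w measure" +
  fixes own :: "'n::finite \<Rightarrow> 'i::finite"
    and \<xi> :: "'w \<Rightarrow> real ^ 'd::finite ^ 'i"
    and \<Omega> :: "'i \<Rightarrow> (real ^ 'n) set"
    and f :: "'i \<Rightarrow> real ^ 'n \<Rightarrow> real ^ 'd \<Rightarrow> real"
    and \<l> :: "'i \<Rightarrow> real ^ 'n \<Rightarrow> real ^ 'd \<Rightarrow> real"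
    and g :: "'i \<Rightarrow> real ^ 'n \<Rightarrow> ereal"
  assumes xi_measurable: "random_variable borel \<xi>"
    and expected_cost_integrable:
      "\<lbrakk>u \<in> agent_space own i; y \<in> opponent_profiles own \<Omega> i\<rbrakk>
         \<Longrightarrow> integrable M (\<lambda>\<omega>. f i (u + y) (\<xi> \<omega> $ i))"
    and expected_cost_convex:
      "y \<in> opponent_profiles own \<Omega> i
         \<Longrightarrow> convex_on (agent_space own i) (\<lambda>u. expectation (\<lambda>\<omega>. f i (u + y) (\<xi> \<omega> $ i)))"
    and expected_cost_C1:
      "y \<in> opponent_profiles own \<Omega> i
         \<Longrightarrow> C1_on (agent_space own i) (\<lambda>u. expectation (\<lambda>\<omega>. f i (u + y) (\<xi> \<omega> $ i)))"
    and cost_convex: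
      "y \<in> opponent_profiles own \<Omega> i
         \<Longrightarrow> convex_on (agent_space own i) (\<lambda>u. f i (u + y) z)"
    and cost_lipschitz:
      "y \<in> opponent_profiles own \<Omega> i
         \<Longrightarrow> (\<l> i y z)-lipschitz_on (agent_space own i) (\<lambda>u. f i (u + y) z)"
    and cost_C1:
      "y \<in> opponent_profiles own \<Omega> i
         \<Longrightarrow> C1_on (agent_space own i) (\<lambda>u. f i (u + y) z)"
    and cost_measurable:
      "\<lbrakk>u \<in> agent_space own i; y \<in> opponent_profiles own \<Omega> i\<rbrakk>
         \<Longrightarrow> (\<lambda>z. f i (u + y) z) \<in> borel_measurable borel"
    and modulus_integrable:
      "y \<in> opponent_profiles own \<Omega> i \<Longrightarrow> integrable M (\<lambda>\<omega>. \<l> i y (\<xi> \<omega> $ i))"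
    and g_proper: "u \<in> agent_space own i \<Longrightarrow> g i u \<noteq> - \<infinity>"
    and g_lsc: "lsc_on (agent_space own i) (g i)"
    and g_convex: "ereal_convex_on (agent_space own i) (g i)"
    and g_dom: "{u \<in> agent_space own i. g i u < \<infinity>} = \<Omega> i"
    and dom_nonempty: "\<Omega> i \<noteq> {}"
    and dom_compact: "compact (\<Omega> i)"
    and dom_convex: "convex (\<Omega> i)"

definition partial_gradient ::
    "('n::finite \<Rightarrow> 'i::finite) \<Rightarrow> ('i \<Rightarrow> real ^ 'n \<Rightarrow> real ^ 'd::finite \<Rightarrow> real)
       \<Rightarrow> 'i \<Rightarrow> real ^ 'n \<Rightarrow> real ^ 'd \<Rightarrow> real ^ 'n" where
  "partial_gradient own f i x z =
     gradient_on (agent_space own i) (\<lambda>u. f i (u + (x - block own i x)) z) (block own i x)"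

definition pseudogradient ::
    "'w measure \<Rightarrow> ('n::finite \<Rightarrow> 'i::finite) \<Rightarrow> ('w \<Rightarrow> real ^ 'd::finite ^ 'i)
       \<Rightarrow> ('i \<Rightarrow> real ^ 'n \<Rightarrow> real ^ 'd \<Rightarrow> real) \<Rightarrow> real ^ 'n \<Rightarrow> real ^ 'n" where
  "pseudogradient M own \<xi> f x =
     col own (\<lambda>i. integral\<^sup>L M (\<lambda>\<omega>. partial_gradient own f i x (\<xi> \<omega> $ i)))"

text \<open>
  The assumptions of \<open>stochastic_game\<close> make the \<open>i\<close>-th block of \<open>pseudogradient\<close>
  continuous in \<open>x\<^sub>i\<close> for each fixed \<open>x\<^sub>-\<^sub>i\<close>, but they put no regularity on the
  dependence on \<open>x\<^sub>-\<^sub>i\<close>.  Joint continuity has to be assumed where it is needed.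
\<close>

definition F_SA ::
    "('n::finite \<Rightarrow> 'i::finite) \<Rightarrow> ('i \<Rightarrow> real ^ 'n \<Rightarrow> real ^ 'd::finite \<Rightarrow> real)
       \<Rightarrow> real ^ 'n \<Rightarrow> real ^ 'd ^ 'i \<Rightarrow> real ^ 'n" where
  "F_SA own f x z = col own (\<lambda>i. partial_gradient own f i x (z $ i))"

definition SOL ::
    "('n::finite \<Rightarrow> 'i::finite) \<Rightarrow> ('i \<Rightarrow> (real ^ 'n) set) \<Rightarrow> (real ^ 'n \<Rightarrow> real ^ 'n)
       \<Rightarrow> ('i \<Rightarrow> real ^ 'n \<Rightarrow> ereal) \<Rightarrow> (real ^ 'n) set" where
  "SOL own \<Omega> F g =
     {xs \<in> profiles own \<Omega>. \<forall>x \<in> profiles own \<Omega>.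
        0 \<le> ereal (F xs \<bullet> (x - xs)) + (\<Sum>i\<in>UNIV. g i (block own i x) - g i (block own i xs))}"

definition iid_samples :: "'w measure \<Rightarrow> ('w \<Rightarrow> 'b::topological_space) \<Rightarrow> (nat \<Rightarrow> 'w \<Rightarrow> 'b) \<Rightarrow> bool" where
  "iid_samples M \<xi> \<Xi> \<longleftrightarrow>
     prob_space.indep_vars M (\<lambda>_. borel) \<Xi> UNIV \<and>
     (\<forall>k. distr M borel (\<Xi> k) = distr M borel \<xi>)"

definition forward_backward_iterates ::
    "'w measure \<Rightarrow> ('n::finite \<Rightarrow> 'i::finite) \<Rightarrow> ('i \<Rightarrow> (real ^ 'n) set)
       \<Rightarrow> ('i \<Rightarrow> real ^ 'n \<Rightarrow> real ^ 'd::finite \<Rightarrow> real) \<Rightarrow> ('i \<Rightarrow> real ^ 'n \<Rightarrow> ereal)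
       \<Rightarrow> (nat \<Rightarrow> real) \<Rightarrow> (nat \<Rightarrow> 'w \<Rightarrow> real ^ 'd ^ 'i) \<Rightarrow> (nat \<Rightarrow> 'w \<Rightarrow> real ^ 'n) \<Rightarrow> bool" where
  "forward_backward_iterates M own \<Omega> f g \<gamma> \<Xi> x \<longleftrightarrow>
     (\<forall>\<omega>\<in>space M. \<forall>i.
        block own i (x 0 \<omega>) \<in> \<Omega> i \<and>
        (\<forall>k. block own i (x (Suc k) \<omega>) =
               prox (agent_space own i) (\<lambda>u. ereal (\<gamma> k) * g i u)
                 (block own i (x k \<omega>) - \<gamma> k *\<^sub>R block own i (F_SA own f (x k \<omega>) (\<Xi> k \<omega>)))))"

definition history ::
    "'w measure \<Rightarrow> ('w \<Rightarrow> 'a::topological_space) \<Rightarrow> (nat \<Rightarrow> 'w \<Rightarrow> 'b::topological_space)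
       \<Rightarrow> nat \<Rightarrow> 'w measure" where
  "history M x0 \<Xi> k = sigma (space M)
     ({x0 -` A \<inter> space M | A. A \<in> sets borel} \<union>
      {\<Xi> m -` A \<inter> space M | m A. m < k \<and> A \<in> sets borel})"

definition stochastic_error ::
    "'w measure \<Rightarrow> ('n::finite \<Rightarrow> 'i::finite) \<Rightarrow> ('w \<Rightarrow> real ^ 'd::finite ^ 'i)
       \<Rightarrow> ('i \<Rightarrow> real ^ 'n \<Rightarrow> real ^ 'd \<Rightarrow> real)
       \<Rightarrow> (nat \<Rightarrow> 'w \<Rightarrow> real ^ 'd ^ 'i) \<Rightarrow> (nat \<Rightarrow> 'w \<Rightarrow> real ^ 'n) \<Rightarrow> nat \<Rightarrow> 'w \<Rightarrow> real ^ 'n" where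
  "stochastic_error M own \<xi> f \<Xi> x k \<omega> =
     F_SA own f (x k \<omega>) (\<Xi> k \<omega>) - pseudogradient M own \<xi> f (x k \<omega>)"

text \<open>
  Conditional expectation of a random vector, coordinate by coordinate.  For a measurable \<open>X\<close>
  that is not integrable it is still the generalized conditional expectation, the difference of
  the conditional expectations of positive and negative parts, wherever
  \<open>\<E>[\<parallel>X\<parallel>\<^sup>2 | H]\<close> is finite.
\<close>

definition vec_cond_exp ::
    "'w measure \<Rightarrow> 'w measure \<Rightarrow> ('w \<Rightarrow> real ^ 'n::finite) \<Rightarrow> 'w \<Rightarrow> real ^ 'n" where
  "vec_cond_exp M H X \<omega> = (\<chi> j. real_cond_exp M H (\<lambda>\<omega>'. X \<omega>' $ j) \<omega>)"

end

theory Submission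
  imports Defs
begin

text \<open>
  Fix the solution \<open>xs\<close> and put \<open>V\<^sub>k = \<parallel>x\<^sub>k - xs\<parallel>\<^sup>2\<close>, \<open>\<theta>(x) = \<langle>F x - F xs, x - xs\<rangle>\<close>.
  Adding the variational inequalities for the proximal point and for \<open>xs\<close> shows that the forward-backward
  step contracts towards \<open>xs\<close>, so that
  \<open>V\<^sub>k\<^sub>+\<^sub>1 \<le> V\<^sub>k + O(\<gamma>\<^sub>k\<^sup>2) - 2 \<gamma>\<^sub>k \<theta>(x\<^sub>k) - 2 \<gamma>\<^sub>k \<langle>\<epsilon>\<^sub>k, x\<^sub>k - xs\<rangle> + 2 \<gamma>\<^sub>k\<^sup>2 \<parallel>\<epsilon>\<^sub>k\<parallel>\<^sup>2\<close>.
  Stopping once the accumulated conditional variance exceeds a level \<open>c\<close> turns this into a bounded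
  nonnegative supermartingale, which converges by Doob's upcrossing inequality; letting \<open>c\<close> run through the
  naturals, almost surely \<open>V\<^sub>k\<close> converges and \<open>\<Sum>\<^sub>k \<gamma>\<^sub>k \<theta>(x\<^sub>k) < \<infinity>\<close>.  Since \<open>\<Sum>\<^sub>k \<gamma>\<^sub>k = \<infinity>\<close> and \<open>\<theta>\<close>
  is bounded away from \<open>0\<close> on the compact set of profiles at a positive distance from \<open>xs\<close>, the limit of
  \<open>V\<^sub>k\<close> is \<open>0\<close>.

  The errors \<open>\<epsilon>\<^sub>k\<close> need not be measurable with respect to \<open>\<F>\<^sub>k\<^sub>+\<^sub>1\<close>, so their weighted sums
  need not form an adapted martingale; only the adapted process \<open>V\<close> is used.
\<close>

section \<open>Proximal points and their variational inequality\<close>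

text \<open>If no point were minimal, every \<open>u\<close> would have a neighbourhood on which
  \<phi> exceeds its value at some \<open>y u\<close> in \<open>S\<close>. In a finite subcover, the
  lowest of the points \<open>y u\<close> lies in one of the neighbourhoods and so is beaten by
  another of them.\<close>

lemma compact_attains_inf_lsc:
  fixes \<phi> :: "'a::topological_space \<Rightarrow> real"
  assumes S: "compact S" "S \<noteq> {}"
    and lsc: "\<And>u q. u \<in> S \<Longrightarrow> q < \<phi> u \<Longrightarrow> \<forall>\<^sub>F y in at u within S. q < \<phi> y"
  shows "\<exists>u\<in>S. \<forall>y\<in>S. \<phi> u \<le> \<phi> y"
proof (rule ccontr)
  assume "\<not> ?thesis"
  then have ex: "\<exists>y\<in>S. \<phi> y < \<phi> u" if "u \<in> S" for u
    using that by (meson not_le)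
  have "\<exists>T y. open T \<and> u \<in> T \<and> y \<in> S \<and> (\<forall>z\<in>T \<inter> S. \<phi> y < \<phi> z)" if u: "u \<in> S" for u
  proof -
    obtain y where y: "y \<in> S" "\<phi> y < \<phi> u" using ex u by blast
    then obtain T where "open T" "u \<in> T" "\<forall>z\<in>T. z \<noteq> u \<longrightarrow> z \<in> S \<longrightarrow> \<phi> y < \<phi> z"
      using lsc[OF u, of "\<phi> y"] unfolding eventually_at_topological by blast
    then show ?thesis using y by (intro exI[of _ T] exI[of _ y]) (use y in auto)
  qed
  then obtain T y where T: "\<And>u. u \<in> S \<Longrightarrow> open (T u) \<and> u \<in> T u \<and> y u \<in> S \<and> (\<forall>z\<in>T u \<inter> S. \<phi> (y u) < \<phi> z)"
    by metis
  obtain C where C: "C \<subseteq> S" "finite C" "S \<subseteq> (\<Union>u\<in>C. T u)"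
    using compactE_image[OF S(1), of S T] T by (metis UN_I subsetI)
  have "C \<noteq> {}" using C S by auto
  then obtain c where c: "c \<in> C" "\<And>d. d \<in> C \<Longrightarrow> \<phi> (y c) \<le> \<phi> (y d)"
    using C(2) arg_min_if_finite(1)[of C "\<lambda>d. \<phi> (y d)"] arg_min_least[of C _ "\<lambda>d. \<phi> (y d)"] by blast
  have "y c \<in> S" using c C T by blast
  then obtain d where d: "d \<in> C" "y c \<in> T d" using C by blast
  then have "\<phi> (y d) < \<phi> (y c)" using T C \<open>y c \<in> S\<close> by blast
  then show False using c(2)[OF d(1)] by simp
qed

text \<open>First-order optimality without subdifferentials: compare the minimiser with points of
  the segment towards \<open>u\<close>, divide by the step \<open>t\<close> and let \<open>t\<close>
  tend to 0. Compactness of the domain and lower semicontinuity guarantee that a minimiser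
  exists.\<close>

lemma prox_variational:
  fixes h :: "'a::euclidean_space \<Rightarrow> ereal" and E :: "'a set"
  defines "S \<equiv> {u \<in> E. h u < \<infinity>}"
  assumes S: "compact S" "S \<noteq> {}"
    and proper: "\<And>u. u \<in> E \<Longrightarrow> h u \<noteq> -\<infinity>"
    and lsc: "lsc_on E h" and conv: "ereal_convex_on E h" and c: "c > 0"
  defines "p \<equiv> \<lambda>v. prox E (\<lambda>u. ereal c * h u) v"
  shows prox_in_dom: "p v \<in> S"
    and prox_inner_le: "u \<in> S \<Longrightarrow> (v - p v) \<bullet> (u - p v) \<le> c * (real_of_ereal (h u) - real_of_ereal (h (p v)))"
proof -
  define r where "r u = real_of_ereal (h u)" for u
  have hr: "h u = ereal (r u)" if "u \<in> S" for u
    using that proper[of u] unfolding S_def r_def by (cases "h u") auto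
  define \<phi> where "\<phi> u = c * r u + 1/2 * (norm (u - v))\<^sup>2" for u
  define \<psi> where "\<psi> u = ereal c * h u + ereal (1/2 * (norm (u - v))\<^sup>2)" for u
  have psiS: "\<psi> u = ereal (\<phi> u)" if "u \<in> S" for u
    using hr[OF that] by (simp add: \<psi>_def \<phi>_def)
  have psiN: "\<psi> u = \<infinity>" if "u \<in> E" "u \<notin> S" for u
    using that c unfolding S_def \<psi>_def by auto
  have lsc': "\<forall>\<^sub>F y in at u within S. q < \<phi> y" if u: "u \<in> S" and q: "q < \<phi> u" for u q
  proof -
    \<comment> \<open>One half of the gap is spent on the term \<open>c * r u\<close>, hence the
      tolerance \<open>e / c\<close> for \<open>h\<close>, and the other half on the quadratic
      term.\<close>
    define e where "e = (\<phi> u - q) / 2"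
    have e: "e > 0" using q by (simp add: e_def)
    have "ereal (r u - e / c) < h u" using e c hr[OF u] by simp
    also have "h u \<le> Liminf (at u within E) h" using lsc u unfolding lsc_on_def S_def by auto
    finally have "\<forall>\<^sub>F y in at u within E. ereal (r u - e / c) < h y" by (rule less_LiminfD)
    then have "\<forall>\<^sub>F y in at u within S. ereal (r u - e / c) < h y"
      by (rule filter_leD[rotated]) (auto intro!: at_le simp: S_def)
    moreover have "((\<lambda>y. 1/2 * (norm (y - v))\<^sup>2) \<longlongrightarrow> 1/2 * (norm (u - v))\<^sup>2) (at u within S)"
      by (intro tendsto_intros)
    then have "\<forall>\<^sub>F y in at u within S. 1/2 * (norm (u - v))\<^sup>2 - e < 1/2 * (norm (y - v))\<^sup>2"
      using e by (intro order_tendstoD(1)) auto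
    moreover have "\<forall>\<^sub>F y in at u within S. y \<in> S" by (simp add: eventually_at_filter)
    ultimately show ?thesis
    proof eventually_elim
      case (elim y)
      then have "r u - e / c < r y" using hr by simp
      then have "c * r u - e < c * r y" using c by (simp add: field_simps)
      then have "\<phi> u - 2 * e < \<phi> y" using elim unfolding \<phi>_def by linarith
      then show ?case by (simp add: e_def field_simps)
    qed
  qed
  obtain m where m: "m \<in> S" "\<And>y. y \<in> S \<Longrightarrow> \<phi> m \<le> \<phi> y"
    using compact_attains_inf_lsc[OF S lsc'] by blast
  have SE: "u \<in> E" if "u \<in> S" for u using that by (simp add: S_def)
  have "is_arg_min \<psi> (\<lambda>u. u \<in> E) m"
    unfolding is_arg_min_def
  proof (intro conjI notI)
    show "m \<in> E" using m SE by blast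
    assume "\<exists>y. y \<in> E \<and> \<psi> y < \<psi> m"
    then obtain y where y: "y \<in> E" "\<psi> y < \<psi> m" by blast
    then have "y \<in> S" using psiN[of y] by fastforce
    then show False using y psiS m by fastforce
  qed
  \<comment> \<open>\<open>arg_min\<close> is a Hilbert choice; the existence of the minimiser
    \<open>m\<close> makes the chosen point \<open>p v\<close> a minimiser too.\<close>
  then have "is_arg_min \<psi> (\<lambda>u. u \<in> E) (p v)"
    unfolding p_def prox_def arg_min_def \<psi>_def by (rule someI)
  then have pE: "p v \<in> E" and pmin: "\<And>y. y \<in> E \<Longrightarrow> \<not> \<psi> y < \<psi> (p v)"
    unfolding is_arg_min_def by auto
  show pS: "p v \<in> S"
  proof (rule ccontr)
    assume "p v \<notin> S"
    then have "\<psi> m < \<psi> (p v)" using psiN[OF pE] psiS[OF m(1)] by simp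
    then show False using pmin SE[OF m(1)] by blast
  qed
  have pm: "\<phi> (p v) \<le> \<phi> y" if "y \<in> S" for y
    using pmin[OF SE[OF that]] psiS[OF that] psiS[OF pS] by simp
  show "(v - p v) \<bullet> (u - p v) \<le> c * (real_of_ereal (h u) - real_of_ereal (h (p v)))" if u: "u \<in> S"
  proof -
    let ?p = "p v"
    \<comment> \<open>Minimality against \<open>?w\<close> gives this inequality multiplied by
      \<open>t\<close>; the last summand is the second-order remainder, which vanishes in the limit
      below.\<close>
    have bd: "(v - ?p) \<bullet> (u - ?p) \<le> c * (r u - r ?p) + t * (1/2 * (norm (u - ?p))\<^sup>2)" if t: "0 < t" "t < 1" for t
    proof -
      let ?w = "(1 - t) *\<^sub>R ?p + t *\<^sub>R u"
      have "h ?w \<le> ereal (1 - t) * h ?p + ereal t * h u"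
        using conv t pE SE[OF u] unfolding ereal_convex_on_def by auto
      also have "\<dots> = ereal ((1 - t) * r ?p + t * r u)" using hr pS u by simp
      finally have hw: "h ?w \<le> ereal ((1 - t) * r ?p + t * r u)" .
      have "?w \<in> E" using conv t pE SE[OF u] unfolding ereal_convex_on_def convex_def by auto
      then have wS: "?w \<in> S" using hw unfolding S_def by (auto simp: order.strict_iff_not top.extremum_unique)
      have rw: "r ?w \<le> (1 - t) * r ?p + t * r u" using hw hr[OF wS] by simp
      have eq: "?w - v = (?p - v) + t *\<^sub>R (u - ?p)" by (simp add: algebra_simps)
      have "(norm (?w - v))\<^sup>2 = (norm (?p - v))\<^sup>2 + 2 * t * ((?p - v) \<bullet> (u - ?p)) + t\<^sup>2 * (norm (u - ?p))\<^sup>2"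
        unfolding eq power2_norm_eq_inner by (simp add: inner_simps inner_commute power2_eq_square algebra_simps)
      moreover have "c * r ?p + 1/2 * (norm (?p - v))\<^sup>2 \<le> c * ((1 - t) * r ?p + t * r u) + 1/2 * (norm (?w - v))\<^sup>2"
        using pm[OF wS] mult_left_mono[OF rw, of c] c unfolding \<phi>_def by linarith
      ultimately have "0 \<le> t * (c * (r u - r ?p) + (?p - v) \<bullet> (u - ?p) + t * (1/2 * (norm (u - ?p))\<^sup>2))"
        by (simp add: algebra_simps power2_eq_square)
      then have "0 \<le> c * (r u - r ?p) + (?p - v) \<bullet> (u - ?p) + t * (1/2 * (norm (u - ?p))\<^sup>2)"
        using t by (simp add: zero_le_mult_iff)
      moreover have "(?p - v) \<bullet> (u - ?p) = - ((v - ?p) \<bullet> (u - ?p))"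
        by (metis inner_minus_left minus_diff_eq)
      ultimately show ?thesis by simp
    qed
    have "((\<lambda>t. c * (r u - r ?p) + t * (1/2 * (norm (u - ?p))\<^sup>2)) \<longlongrightarrow> c * (r u - r ?p) + 0 * (1/2 * (norm (u - ?p))\<^sup>2)) (at_right 0)"
      by (intro tendsto_intros)
    moreover have "\<forall>\<^sub>F t in at_right (0::real). (v - ?p) \<bullet> (u - ?p) \<le> c * (r u - r ?p) + t * (1/2 * (norm (u - ?p))\<^sup>2)"
      unfolding eventually_at_right_field using bd by (intro exI[of _ 1]) auto
    ultimately have "(v - ?p) \<bullet> (u - ?p) \<le> c * (r u - r ?p) + 0 * (1/2 * (norm (u - ?p))\<^sup>2)"
      by (intro tendsto_lowerbound) (auto simp: trivial_limit_at_right_real)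
    then show ?thesis by (simp add: r_def)
  qed
qed

section \<open>Blocks of a profile and one forward-backward step\<close>

lemma block_in_agent_space: "block own i x \<in> agent_space own i"
  by (simp add: block_def agent_space_def)

lemma linear_block: "linear (block own i)"
  by (rule linearI) (simp_all add: block_def vec_eq_iff)

lemma block_diff: "block own i (x - y) = block own i x - block own i y"
  and block_scaleR: "block own i (c *\<^sub>R x) = c *\<^sub>R block own i x"
  using linear_diff[OF linear_block] linear_scale[OF linear_block] by blast+

lemma sum_block: "(\<Sum>i\<in>UNIV. block own i x) = x"
  by (simp add: block_def vec_eq_iff sum_component)

text \<open>Every coordinate has exactly one owner, so after swapping the sums the inner one has a
  single nonzero term at most.\<close>

lemma sum_inner_block: "(\<Sum>i\<in>UNIV. block own i x \<bullet> block own i y) = x \<bullet> y"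
proof -
  have "(\<Sum>i\<in>UNIV. block own i x \<bullet> block own i y) =
      (\<Sum>j\<in>UNIV. \<Sum>i\<in>UNIV. if own j = i then x $ j * y $ j else 0)"
    unfolding inner_vec_def block_def by (subst sum.swap) (simp add: if_distrib cong: if_cong)
  then show ?thesis by (simp add: inner_vec_def)
qed

text \<open>Expand the square and bound the norm of \<Delta> + e by the parallelogram law. It is
  meant for \<Delta> the increment of the pseudogradient from \<open>xs\<close>, \<open>d\<close>
  the displacement from \<open>xs\<close>, and \<open>e\<close> the stochastic error.\<close>

lemma norm_diff_scaleR_le:
  fixes d :: "'a::real_inner"
  assumes "norm \<Delta> \<le> L * norm d"
  shows "(norm (d - c *\<^sub>R (\<Delta> + e)))\<^sup>2
    \<le> (norm d)\<^sup>2 + 2 * c\<^sup>2 * L\<^sup>2 * (norm d)\<^sup>2 - 2 * c * (\<Delta> \<bullet> d) - 2 * c * (e \<bullet> d) + 2 * c\<^sup>2 * (norm e)\<^sup>2"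
proof -
  have "(norm (d - c *\<^sub>R (\<Delta> + e)))\<^sup>2 = (norm d)\<^sup>2 - 2 * c * (\<Delta> \<bullet> d) - 2 * c * (e \<bullet> d) + c\<^sup>2 * (norm (\<Delta> + e))\<^sup>2"
    unfolding power2_norm_eq_inner by (simp add: inner_simps inner_commute power2_eq_square algebra_simps)
  moreover have "(norm (\<Delta> + e))\<^sup>2 \<le> 2 * (norm \<Delta>)\<^sup>2 + 2 * (norm e)\<^sup>2"
  proof -
    have "0 \<le> (norm (\<Delta> - e))\<^sup>2" by simp
    then show ?thesis unfolding power2_norm_eq_inner by (simp add: inner_simps inner_commute)
  qed
  then have "c\<^sup>2 * (norm (\<Delta> + e))\<^sup>2 \<le> c\<^sup>2 * (2 * (L * norm d)\<^sup>2 + 2 * (norm e)\<^sup>2)"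
    using power_mono[OF assms, of 2] by (intro mult_left_mono) auto
  ultimately show ?thesis by (simp add: power_mult_distrib algebra_simps)
qed

context stochastic_game
begin

lemma compact_profiles: "compact (profiles own \<Omega>)"
proof -
  have eq: "profiles own \<Omega> = (\<Inter>i. block own i -` \<Omega> i)" by (auto simp: profiles_def)
  have "closed (block own i -` \<Omega> i)" for i
    using dom_compact compact_imp_closed linear_block
    by (intro closed_vimage linear_continuous_on linear_conv_bounded_linear[THEN iffD1]) auto
  then have "closed (profiles own \<Omega>)" unfolding eq by blast
  moreover have "bounded (profiles own \<Omega>)"
  proof -
    have "\<exists>b. \<forall>u\<in>\<Omega> i. norm u \<le> b" for i using compact_imp_bounded[OF dom_compact] by (simp add: bounded_iff)
    then obtain b where b: "\<And>i u. u \<in> \<Omega> i \<Longrightarrow> norm u \<le> b i" by metis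
    have "norm x \<le> (\<Sum>i\<in>UNIV. b i)" if "x \<in> profiles own \<Omega>" for x
    proof -
      have "norm x \<le> (\<Sum>i\<in>UNIV. norm (block own i x))" by (metis norm_sum sum_block)
      also have "\<dots> \<le> (\<Sum>i\<in>UNIV. b i)" using that b by (intro sum_mono) (auto simp: profiles_def)
      finally show ?thesis .
    qed
    then show ?thesis by (auto simp: bounded_iff)
  qed
  ultimately show ?thesis by (simp add: compact_eq_bounded_closed)
qed

lemma g_real: "u \<in> \<Omega> i \<Longrightarrow> g i u = ereal (real_of_ereal (g i u))"
  using g_dom[of i] g_proper[of u i] by (cases "g i u") auto

text \<open>Test each agent's proximal inequality at the block of \<open>xs\<close>, sum over the
  agents, and add \<open>c\<close> times the variational inequality for \<open>xs\<close> tested at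
  \<open>x'\<close>. The costs \<open>g\<close> cancel, and Cauchy-Schwarz gives the
  estimate.\<close>

lemma
  assumes sol: "xs \<in> SOL own \<Omega> F g" and c: "c > 0"
    and step: "\<And>i. block own i x' = prox (agent_space own i) (\<lambda>u. ereal c * g i u)
        (block own i x - c *\<^sub>R block own i v)"
  shows forward_backward_step_in_profiles: "x' \<in> profiles own \<Omega>"
    and forward_backward_step_le: "norm (x' - xs) \<le> norm (x - xs - c *\<^sub>R (v - F xs))"
proof -
  define r where "r i u = real_of_ereal (g i u)" for i u
  let ?w = "x - c *\<^sub>R v"
  have w: "block own i x - c *\<^sub>R block own i v = block own i ?w" for i
    by (simp add: block_diff block_scaleR)
  note dom = dom_compact dom_nonempty
  have in_dom: "block own i x' \<in> \<Omega> i" for i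
    using prox_in_dom[of "agent_space own i" "g i", unfolded g_dom, OF dom g_proper g_lsc g_convex c]
    unfolding step w by blast
  then show x': "x' \<in> profiles own \<Omega>" by (simp add: profiles_def)
  have xs: "block own i xs \<in> \<Omega> i" for i using sol by (simp add: SOL_def profiles_def)
  have "(block own i ?w - block own i x') \<bullet> (block own i xs - block own i x')
      \<le> c * (r i (block own i xs) - r i (block own i x'))" for i
    using prox_inner_le[of "agent_space own i" "g i", unfolded g_dom, OF dom g_proper g_lsc g_convex c xs, of "block own i ?w"]
    unfolding step w r_def by blast
  then have "(\<Sum>i\<in>UNIV. block own i (?w - x') \<bullet> block own i (xs - x'))
      \<le> (\<Sum>i\<in>UNIV. c * (r i (block own i xs) - r i (block own i x')))"
    unfolding block_diff by (intro sum_mono)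
  then have 1: "(?w - x') \<bullet> (xs - x') \<le> - c * (\<Sum>i\<in>UNIV. r i (block own i x') - r i (block own i xs))"
    unfolding sum_inner_block by (simp add: sum_distrib_left[symmetric] sum_subtractf algebra_simps)
  have "0 \<le> ereal (F xs \<bullet> (x' - xs)) + (\<Sum>i\<in>UNIV. g i (block own i x') - g i (block own i xs))"
    using sol x' by (simp add: SOL_def)
  also have "(\<Sum>i\<in>UNIV. g i (block own i x') - g i (block own i xs)) =
      (\<Sum>i\<in>UNIV. ereal (r i (block own i x') - r i (block own i xs)))"
    using g_real[OF in_dom] g_real[OF xs] unfolding r_def by (intro sum.cong) (metis ereal_minus(1))+
  finally have "0 \<le> F xs \<bullet> (x' - xs) + (\<Sum>i\<in>UNIV. r i (block own i x') - r i (block own i xs))"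
    by (simp add: zero_ereal_def)
  then have "c * 0 \<le> c * (F xs \<bullet> (x' - xs) + (\<Sum>i\<in>UNIV. r i (block own i x') - r i (block own i xs)))"
    using c by (intro mult_left_mono) auto
  \<comment> \<open>Here the two sums of differences of \<open>g\<close> cancel.\<close>
  with 1 have "(?w - x') \<bullet> (xs - x') \<le> c * (F xs \<bullet> (x' - xs))" by (simp add: algebra_simps)
  then have "(x' - xs) \<bullet> (x' - xs) \<le> (x - xs - c *\<^sub>R (v - F xs)) \<bullet> (x' - xs)"
    by (simp add: inner_simps inner_commute algebra_simps)
  also have "\<dots> \<le> norm (x - xs - c *\<^sub>R (v - F xs)) * norm (x' - xs)" by (rule norm_cauchy_schwarz)
  finally have "norm (x' - xs) * norm (x' - xs) \<le> norm (x - xs - c *\<^sub>R (v - F xs)) * norm (x' - xs)"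
    by (simp add: dot_square_norm power2_eq_square)
  then show "norm (x' - xs) \<le> norm (x - xs - c *\<^sub>R (v - F xs))"
    by (cases "x' = xs") auto
qed

end

section \<open>Almost sure summability, oscillation and upcrossings\<close>

text \<open>By monotone convergence the whole series has expectation at most \<open>C\<close>, so it
  is finite almost everywhere.\<close>

lemma (in prob_space) AE_summable_if_expectations_bounded:
  fixes t :: "nat \<Rightarrow> 'a \<Rightarrow> real"
  assumes int: "\<And>k. integrable M (t k)" and nonneg: "\<And>k \<omega>. \<omega> \<in> space M \<Longrightarrow> 0 \<le> t k \<omega>"
    and bound: "\<And>n. (\<Sum>k<n. expectation (t k)) \<le> C"
  shows "AE \<omega> in M. summable (\<lambda>k. t k \<omega>)"
proof -
  have [measurable]: "t k \<in> borel_measurable M" for k using int by blast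
  have "(\<integral>\<^sup>+\<omega>. (\<Sum>k. ennreal (t k \<omega>)) \<partial>M) = (\<Sum>k. \<integral>\<^sup>+\<omega>. ennreal (t k \<omega>) \<partial>M)"
    by (rule nn_integral_suminf) simp
  also have "\<dots> = (\<Sum>k. ennreal (expectation (t k)))"
    using int nonneg by (intro suminf_cong nn_integral_eq_integral) auto
  also have "\<dots> \<le> ennreal C"
  proof (rule suminf_le_const)
    fix n
    have "(\<Sum>k<n. ennreal (expectation (t k))) = ennreal (\<Sum>k<n. expectation (t k))"
      using nonneg by (intro sum_ennreal integral_nonneg_AE) auto
    then show "(\<Sum>k<n. ennreal (expectation (t k))) \<le> ennreal C"
      using bound by (simp add: ennreal_leI)
  qed simp
  finally have "(\<integral>\<^sup>+\<omega>. (\<Sum>k. ennreal (t k \<omega>)) \<partial>M) \<noteq> \<infinity>" by (auto simp: top_unique)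
  then have "AE \<omega> in M. (\<Sum>k. ennreal (t k \<omega>)) \<noteq> \<infinity>"
    by (intro nn_integral_PInf_AE) auto
  with AE_space show ?thesis
    by eventually_elim (use nonneg in \<open>auto intro!: summable_suminf_not_top\<close>)
qed

text \<open>A bounded sequence has a cluster point \<open>l\<close>; leaving a neighbourhood of
  \<open>l\<close> infinitely often would mean crossing some gap between two levels infinitely
  often. The levels are rational so that countably many almost sure statements suffice
  later.\<close>

lemma convergent_if_no_oscillation:
  fixes y :: "nat \<Rightarrow> real"
  assumes bounded: "\<And>n. 0 \<le> y n" "\<And>n. y n \<le> K"
    and osc: "\<And>a b. \<lbrakk>a \<in> \<rat>; b \<in> \<rat>; a < b; \<exists>\<^sub>F n in sequentially. y n < a\<rbrakk> \<Longrightarrow> \<forall>\<^sub>F n in sequentially. y n \<le> b"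
  shows "convergent y"
proof -
  obtain l r where r: "strict_mono r" "(y \<circ> r) \<longlonglongrightarrow> l"
    using compact_Icc[of 0 K] bounded unfolding compact_def by (metis atLeastAtMost_iff)
  have freq: "\<exists>\<^sub>F n in sequentially. P (y n)" if "\<forall>\<^sub>F n in sequentially. P (y (r n))" for P
    unfolding frequently_sequentially
    using that r(1) unfolding eventually_sequentially
    by (metis linorder_le_cases order_trans seq_suble)
  have "y \<longlonglongrightarrow> l"
  proof (rule order_tendstoI)
    fix c assume "l < c"
    then obtain d where d: "l < d" "d < c" using dense by blast
    obtain a where a: "a \<in> \<rat>" "l < a" "a < d" using Rats_dense_in_real d by blast
    obtain b where b: "b \<in> \<rat>" "d < b" "b < c" using Rats_dense_in_real d by blast
    have "\<exists>\<^sub>F n in sequentially. y n < a"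
      using order_tendstoD(2)[OF r(2) a(2)] by (intro freq) simp
    from osc[OF a(1) b(1) _ this] show "\<forall>\<^sub>F n in sequentially. y n < c"
      using a b by (auto elim: eventually_mono)
  next
    fix c assume "c < l"
    then obtain d where d: "c < d" "d < l" using dense by blast
    obtain a where a: "a \<in> \<rat>" "c < a" "a < d" using Rats_dense_in_real d by blast
    obtain b where b: "b \<in> \<rat>" "d < b" "b < l" using Rats_dense_in_real d by blast
    have "\<exists>\<^sub>F n in sequentially. b < y n"
      using order_tendstoD(1)[OF r(2) b(3)] by (intro freq) simp
    then have "\<not> (\<forall>\<^sub>F n in sequentially. y n \<le> b)" by (simp add: frequently_def not_less)
    then have "\<not> (\<exists>\<^sub>F n in sequentially. y n < a)" using osc[OF a(1) b(1)] a b by auto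
    then show "\<forall>\<^sub>F n in sequentially. c < y n"
      unfolding not_frequently using a by (auto elim: eventually_mono)
  qed
  then show ?thesis by (auto simp: convergent_def)
qed

text \<open>The strategy of the upcrossing inequality: buy below \<open>a\<close>, sell above \<open>b\<close>.\<close>

primrec holding :: "real \<Rightarrow> real \<Rightarrow> (nat \<Rightarrow> real) \<Rightarrow> nat \<Rightarrow> bool" where
  "holding a b y 0 \<longleftrightarrow> y 0 < a"
| "holding a b y (Suc n) \<longleftrightarrow> (if holding a b y n then y (Suc n) \<le> b else y (Suc n) < a)"

text \<open>A completed upcrossing is counted once, at the last time before the sale.\<close>

definition upcrossing :: "real \<Rightarrow> real \<Rightarrow> (nat \<Rightarrow> real) \<Rightarrow> nat \<Rightarrow> bool" where
  "upcrossing a b y n \<longleftrightarrow> holding a b y n \<and> \<not> holding a b y (Suc n)"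

text \<open>Each completed round trip earns at least \<open>b - a\<close>. The second term on the
  left values a position still open at time \<open>n\<close>; it makes the induction go
  through.\<close>

lemma upcrossing_gain:
  assumes "a < b"
  shows "(b - a) * (\<Sum>k<n. of_bool (upcrossing a b y k)) + of_bool (holding a b y n) * (y n - a)
    \<le> (\<Sum>k<n. of_bool (holding a b y k) * (y (Suc k) - y k))"
proof (induction n)
  case (Suc n)
  consider "holding a b y n" "holding a b y (Suc n)" | "\<not> holding a b y n" "holding a b y (Suc n)"
    | "holding a b y n" "\<not> holding a b y (Suc n)" | "\<not> holding a b y n" "\<not> holding a b y (Suc n)"
    by blast
  then show ?case
    using Suc assms by cases (simp_all add: upcrossing_def distrib_left del: holding.simps(2) sum_of_bool_eq, simp_all)
qed simp

text \<open>Once no further sale occurs, a value below \<open>a\<close> starts a position that is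
  held forever, and holding keeps the values at most \<open>b\<close>.\<close>

lemma eventually_le_if_finitely_many_upcrossings:
  assumes fin: "\<forall>\<^sub>F n in sequentially. \<not> upcrossing a b y n"
    and low: "\<exists>\<^sub>F n in sequentially. y n < a" and "a < b"
  shows "\<forall>\<^sub>F n in sequentially. y n \<le> b"
proof -
  obtain N where N: "\<And>n. n \<ge> N \<Longrightarrow> \<not> upcrossing a b y n"
    using fin unfolding eventually_sequentially by blast
  obtain m where m: "m \<ge> Suc N" "y m < a" using low unfolding frequently_sequentially by blast
  have m_holding: "holding a b y m" using m assms(3) by (cases m) auto
  have "holding a b y n" if "n \<ge> m" for n
    using that
  proof (induction n rule: dec_induct)
    case base
    show ?case by (rule m_holding)
  next
    case (step n)
    then show ?case using N[of n] m by (simp add: upcrossing_def del: holding.simps)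
  qed
  note hold = this
  have "y n \<le> b" if "n \<ge> Suc m" for n
  proof -
    from that obtain k where k: "n = Suc k" "k \<ge> m" by (auto dest!: Suc_le_D)
    then show ?thesis using hold[of k] hold[of "Suc k"] by simp
  qed
  then show ?thesis unfolding eventually_sequentially by blast
qed

section \<open>Filtrations and convergence of bounded supermartingales\<close>

locale filtered_prob_space = prob_space M for M :: "'w measure" +
  fixes F :: "nat \<Rightarrow> 'w measure"
  assumes subalg: "subalgebra M (F n)"
    and sets_Suc: "sets (F n) \<subseteq> sets (F (Suc n))"
begin

lemma space_F [simp]: "space (F n) = space M"
  using subalg by (simp add: subalgebra_def)

lemma subalgebra_mono: "m \<le> n \<Longrightarrow> subalgebra (F n) (F m)"
  using lift_Suc_mono_le[of "\<lambda>n. sets (F n)"] sets_Suc by (auto simp: subalgebra_def)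

lemma measurable_mono: "f \<in> measurable (F m) N \<Longrightarrow> m \<le> n \<Longrightarrow> f \<in> measurable (F n) N"
  using measurable_from_subalg subalgebra_mono by blast

lemma measurable_M: "f \<in> measurable (F m) N \<Longrightarrow> f \<in> measurable M N"
  using measurable_from_subalg subalg by blast

context
  fixes Y :: "nat \<Rightarrow> 'w \<Rightarrow> real" and K :: real
  assumes adapted: "\<And>n. Y n \<in> borel_measurable (F n)"
    and bounded: "\<And>n \<omega>. \<omega> \<in> space M \<Longrightarrow> 0 \<le> Y n \<omega> \<and> Y n \<omega> \<le> K"
begin

lemma integrable_bounded_adapted: "integrable M (Y n)"
  using bounded[of _ n] by (intro integrable_const_bound[of _ K] measurable_M[OF adapted]) auto

lemma holding_adapted: "Measurable.pred (F n) (\<lambda>\<omega>. holding a b (\<lambda>k. Y k \<omega>) n)"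
proof (induction n)
  case 0
  note adapted[of 0, measurable]
  show ?case by simp
next
  case (Suc n)
  note adapted[of "Suc n", measurable] measurable_mono[OF Suc, of "Suc n", measurable]
  show ?case by simp
qed

text \<open>Doob's argument: the event of holding at time \<open>k\<close> lies in
  \<open>F k\<close>, so the expected gain of the strategy is at most 0. This bounds the expected
  number of upcrossings of every pair of levels.\<close>

lemma bounded_supermartingale_converges:
  assumes drift: "\<And>n B. B \<in> sets (F n) \<Longrightarrow>
      expectation (\<lambda>\<omega>. indicat_real B \<omega> * Y (Suc n) \<omega>) \<le> expectation (\<lambda>\<omega>. indicat_real B \<omega> * Y n \<omega>)"
  shows "AE \<omega> in M. convergent (\<lambda>n. Y n \<omega>)"
proof -
  have Y[measurable]: "Y n \<in> borel_measurable M" for n by (rule measurable_M[OF adapted])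
  have osc: "AE \<omega> in M. \<forall>\<^sub>F n in sequentially. \<not> upcrossing a b (\<lambda>k. Y k \<omega>) n"
    if ab: "0 \<le> a" "a < b" for a b
  proof -
    note [simp del] = sum_of_bool_eq sum_of_bool_mult_eq sum_mult_of_bool_eq holding.simps
    let ?h = "\<lambda>n \<omega>. holding a b (\<lambda>k. Y k \<omega>) n"
    let ?t = "\<lambda>n \<omega>. of_bool (upcrossing a b (\<lambda>k. Y k \<omega>) n) :: real"
    have [measurable]: "Measurable.pred M (?h n)" for n by (rule measurable_M[OF holding_adapted])
    have [measurable]: "?t n \<in> borel_measurable M" for n
      unfolding upcrossing_def by (simp del: holding.simps)
    have it: "integrable M (?t n)" for n by (rule integrable_const_bound[of _ 1]) auto
    have ih: "integrable M (\<lambda>\<omega>. of_bool (?h n \<omega>) * Y m \<omega>)" for n m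
      using bounded[of _ m] by (intro integrable_const_bound[of _ K] AE_I2) (auto simp: abs_if dest: leD intro: order_trans)
    have "(\<Sum>k<n. expectation (?t k)) \<le> a / (b - a)" for n
    proof -
      have step: "expectation (\<lambda>\<omega>. of_bool (?h k \<omega>) * Y (Suc k) \<omega>) \<le> expectation (\<lambda>\<omega>. of_bool (?h k \<omega>) * Y k \<omega>)" for k
      proof -
        let ?B = "{\<omega> \<in> space M. ?h k \<omega>}"
        have "?B \<in> sets (F k)" using holding_adapted[where n=k and a=a and b=b] by (simp add: pred_def)
        moreover have "expectation (\<lambda>\<omega>. of_bool (?h k \<omega>) * Y m \<omega>) = expectation (\<lambda>\<omega>. indicat_real ?B \<omega> * Y m \<omega>)" for m
          by (intro Bochner_Integration.integral_cong) (auto simp: indicator_def)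
        ultimately show ?thesis using drift by simp
      qed
      have "(b - a) * (\<Sum>k<n. expectation (?t k)) - a = expectation (\<lambda>\<omega>. (b - a) * (\<Sum>k<n. ?t k \<omega>) - a)"
        using it by (simp add: prob_space)
      also have "\<dots> \<le> expectation (\<lambda>\<omega>. \<Sum>k<n. of_bool (?h k \<omega>) * Y (Suc k) \<omega> - of_bool (?h k \<omega>) * Y k \<omega>)"
      proof (rule integral_mono)
        fix \<omega> assume w: "\<omega> \<in> space M"
        \<comment> \<open>Since \<open>Y\<close> is nonnegative, an open position costs at most
          \<open>a\<close>; hence the bound \<open>a / (b - a)\<close>.\<close>
        have "- a \<le> of_bool (?h n \<omega>) * (Y n \<omega> - a)" using bounded[OF w, of n] ab by auto
        then show "(b - a) * (\<Sum>k<n. ?t k \<omega>) - a \<le> (\<Sum>k<n. of_bool (?h k \<omega>) * Y (Suc k) \<omega> - of_bool (?h k \<omega>) * Y k \<omega>)"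
          using upcrossing_gain[OF ab(2), where n=n and y="\<lambda>k. Y k \<omega>"] by (simp add: right_diff_distrib del: holding.simps)
      qed (use it ih in auto)
      also have "\<dots> = (\<Sum>k<n. expectation (\<lambda>\<omega>. of_bool (?h k \<omega>) * Y (Suc k) \<omega>) - expectation (\<lambda>\<omega>. of_bool (?h k \<omega>) * Y k \<omega>))"
        using ih by (simp add: Bochner_Integration.integral_sum)
      also have "\<dots> \<le> 0" using step by (intro sum_nonpos) simp
      finally show ?thesis using ab by (simp add: field_simps)
    qed
    then have "AE \<omega> in M. summable (\<lambda>k. ?t k \<omega>)"
      by (intro AE_summable_if_expectations_bounded it) auto
    then show ?thesis
    proof eventually_elim
      case (elim \<omega>)
      \<comment> \<open>A summable sequence of zeros and ones is eventually zero.\<close>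
      then have "\<forall>\<^sub>F n in sequentially. ?t n \<omega> < 1"
        by (intro order_tendstoD(2)[OF summable_LIMSEQ_zero]) auto
      then show ?case by (rule eventually_mono) (auto split: if_splits)
    qed
  qed
  have "AE \<omega> in M. \<forall>a\<in>\<rat>. \<forall>b\<in>\<rat>. 0 \<le> a \<longrightarrow> a < b \<longrightarrow> (\<forall>\<^sub>F n in sequentially. \<not> upcrossing a b (\<lambda>k. Y k \<omega>) n)"
    using osc by (simp add: AE_ball_countable countable_rat)
  with AE_space show ?thesis
  proof eventually_elim
    case (elim \<omega>)
    show ?case
    proof (rule convergent_if_no_oscillation[where K=K])
      fix a b :: real assume ab: "a \<in> \<rat>" "b \<in> \<rat>" "a < b" and low: "\<exists>\<^sub>F n in sequentially. Y n \<omega> < a"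
      then obtain m where "Y m \<omega> < a" unfolding frequently_sequentially by blast
      then have "0 \<le> a" using bounded[OF elim(1), of m] by linarith
      then show "\<forall>\<^sub>F n in sequentially. Y n \<omega> \<le> b"
        using elim ab low by (intro eventually_le_if_finitely_many_upcrossings[where a=a and b=b]) auto
    qed (use bounded elim in auto)
  qed
qed

text \<open>Dropping \<open>U\<close> leaves a supermartingale. Keeping it, the drift over the whole
  space telescopes, and the expectations of \<open>U\<close> sum to at most that of
  \<open>Y 0\<close>.\<close>

lemma bounded_robbins_siegmund:
  assumes U: "\<And>n. integrable M (U n)" "\<And>n \<omega>. \<omega> \<in> space M \<Longrightarrow> 0 \<le> U n \<omega>"
    and drift: "\<And>n B. B \<in> sets (F n) \<Longrightarrow>
      expectation (\<lambda>\<omega>. indicat_real B \<omega> * Y (Suc n) \<omega>) \<le> expectation (\<lambda>\<omega>. indicat_real B \<omega> * (Y n \<omega> - U n \<omega>))"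
  shows "AE \<omega> in M. convergent (\<lambda>n. Y n \<omega>)" and "AE \<omega> in M. summable (\<lambda>n. U n \<omega>)"
proof -
  show "AE \<omega> in M. convergent (\<lambda>n. Y n \<omega>)"
  proof (rule bounded_supermartingale_converges)
    fix n B assume B: "B \<in> sets (F n)"
    then have BM: "B \<in> sets M" using subalg by (auto simp: subalgebra_def)
    have "expectation (\<lambda>\<omega>. indicat_real B \<omega> * Y (Suc n) \<omega>) \<le> expectation (\<lambda>\<omega>. indicat_real B \<omega> * (Y n \<omega> - U n \<omega>))"
      by (rule drift[OF B])
    also have "expectation (\<lambda>\<omega>. indicat_real B \<omega> * (Y n \<omega> - U n \<omega>)) \<le> expectation (\<lambda>\<omega>. indicat_real B \<omega> * Y n \<omega>)"
    proof (rule integral_mono)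
      show "integrable M (\<lambda>\<omega>. indicat_real B \<omega> * (Y n \<omega> - U n \<omega>))" "integrable M (\<lambda>\<omega>. indicat_real B \<omega> * Y n \<omega>)"
        using BM U integrable_bounded_adapted by (auto intro!: integrable_real_mult_indicator simp: mult.commute[of "indicat_real B _"])
    qed (use U in \<open>auto simp: indicator_def\<close>)
    finally show "expectation (\<lambda>\<omega>. indicat_real B \<omega> * Y (Suc n) \<omega>) \<le> expectation (\<lambda>\<omega>. indicat_real B \<omega> * Y n \<omega>)" .
  qed
  show "AE \<omega> in M. summable (\<lambda>n. U n \<omega>)"
  proof (rule AE_summable_if_expectations_bounded[OF U])
    fix n
    have "expectation (U k) \<le> expectation (Y k) - expectation (Y (Suc k))" for k
    proof -
      have eq: "expectation (\<lambda>\<omega>. indicat_real (space M) \<omega> * h \<omega>) = expectation h" for h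
        by (intro Bochner_Integration.integral_cong) auto
      show ?thesis
        using drift[of "space M" k] sets.top[of "F k"] U integrable_bounded_adapted
        by (simp add: eq)
    qed
    then have "(\<Sum>k<n. expectation (U k)) \<le> (\<Sum>k<n. expectation (Y k) - expectation (Y (Suc k)))"
      by (rule sum_mono)
    also have "\<dots> = expectation (Y 0) - expectation (Y n)" by (rule sum_lessThan_telescope')
    also have "\<dots> \<le> expectation (Y 0)" using bounded by (simp add: integral_nonneg_AE)
    finally show "(\<Sum>k<n. expectation (U k)) \<le> expectation (Y 0)" .
  qed
qed

end

end

section \<open>Conditional expectations of errors that may fail to be integrable\<close>

context sigma_finite_subalgebra
begin

text \<open>\<open>h\<close> may have infinite mean. On an event of the subalgebra where its
  conditional expectation is bounded, the defining identity of \<open>nn_cond_exp\<close> yields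
  integrability, and the passage to real values loses nothing there.\<close>

lemma indicator_mult_nn_cond_exp:
  assumes B: "B \<in> sets F" "emeasure M B < \<infinity>"
    and h[measurable]: "h \<in> borel_measurable M" and nonneg: "\<And>\<omega>. 0 \<le> h \<omega>"
    and bound: "\<And>\<omega>. \<omega> \<in> B \<Longrightarrow> nn_cond_exp M F (\<lambda>\<omega>. ennreal (h \<omega>)) \<omega> \<le> ennreal q"
  defines "s \<equiv> \<lambda>\<omega>. enn2real (nn_cond_exp M F (\<lambda>\<omega>. ennreal (h \<omega>)) \<omega>)"
  shows integrable_indicator_mult: "integrable M (\<lambda>\<omega>. indicat_real B \<omega> * h \<omega>)"
    and integrable_indicator_mult_cond_exp: "integrable M (\<lambda>\<omega>. indicat_real B \<omega> * s \<omega>)"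
    and integral_indicator_mult_cond_exp:
      "integral\<^sup>L M (\<lambda>\<omega>. indicat_real B \<omega> * s \<omega>) = integral\<^sup>L M (\<lambda>\<omega>. indicat_real B \<omega> * h \<omega>)"
proof -
  let ?S = "nn_cond_exp M F (\<lambda>\<omega>. ennreal (h \<omega>))"
  have [measurable]: "B \<in> sets M" using B subalg by (auto simp: subalgebra_def)
  have [measurable]: "?S \<in> borel_measurable M" by simp
  have [measurable]: "s \<in> borel_measurable M" unfolding s_def by simp
  have eqh: "ennreal (indicat_real B \<omega> * h \<omega>) = indicator B \<omega> * ennreal (h \<omega>)" for \<omega>
    by (simp add: indicator_def)
  have eqs: "ennreal (indicat_real B \<omega> * s \<omega>) = indicator B \<omega> * ?S \<omega>" for \<omega>
    using bound[of \<omega>] by (auto simp: s_def indicator_def ennreal_enn2real_if top_unique)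
  have I: "(\<integral>\<^sup>+\<omega>. ennreal (indicat_real B \<omega> * s \<omega>) \<partial>M) = (\<integral>\<^sup>+\<omega>. ennreal (indicat_real B \<omega> * h \<omega>) \<partial>M)"
    unfolding eqh eqs using B by (intro nn_cond_exp_intg) auto
  have "(\<integral>\<^sup>+\<omega>. ennreal (indicat_real B \<omega> * s \<omega>) \<partial>M) \<le> (\<integral>\<^sup>+\<omega>. ennreal q * indicator B \<omega> \<partial>M)"
    unfolding eqs using bound by (intro nn_integral_mono) (auto simp: indicator_def)
  also have "\<dots> < \<infinity>" using B by (simp add: nn_integral_cmult_indicator ennreal_mult_less_top)
  finally have fin: "(\<integral>\<^sup>+\<omega>. ennreal (indicat_real B \<omega> * s \<omega>) \<partial>M) < \<infinity>" .
  have s0: "0 \<le> s \<omega>" for \<omega> by (simp add: s_def)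
  show "integrable M (\<lambda>\<omega>. indicat_real B \<omega> * s \<omega>)"
    using fin s0 by (intro integrableI_nonneg) auto
  show "integrable M (\<lambda>\<omega>. indicat_real B \<omega> * h \<omega>)"
    using fin nonneg unfolding I by (intro integrableI_nonneg) auto
  show "integral\<^sup>L M (\<lambda>\<omega>. indicat_real B \<omega> * s \<omega>) = integral\<^sup>L M (\<lambda>\<omega>. indicat_real B \<omega> * h \<omega>)"
    using I s0 nonneg by (simp add: integral_eq_nn_integral)
qed

text \<open>In each coordinate the \<open>F\<close>-measurable factor is pulled out of the
  conditional expectation. Integrability is asked of the product of the norms, since
  \<open>e\<close> itself may fail to be integrable.\<close>

lemma integral_inner_eq_0_if_vec_cond_exp_eq_0:
  fixes d e :: "'a \<Rightarrow> real ^ 'n::finite"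
  assumes d: "d \<in> borel_measurable F" and e: "e \<in> borel_measurable M"
    and int: "integrable M (\<lambda>\<omega>. norm (d \<omega>) * norm (e \<omega>))"
    and zero: "AE \<omega> in M. vec_cond_exp M F e \<omega> = 0"
  shows "integrable M (\<lambda>\<omega>. e \<omega> \<bullet> d \<omega>)" and "integral\<^sup>L M (\<lambda>\<omega>. e \<omega> \<bullet> d \<omega>) = 0"
proof -
  note e[measurable] and d[measurable]
  have dM[measurable]: "d \<in> borel_measurable M" using measurable_from_subalg[OF subalg d] .
  have dj: "(\<lambda>\<omega>. d \<omega> $ j) \<in> borel_measurable F" for j
    by (rule measurable_compose[OF d]) simp
  have ej: "(\<lambda>\<omega>. e \<omega> $ j) \<in> borel_measurable M" for j
    by (rule measurable_compose[OF e]) simp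
  have ij: "integrable M (\<lambda>\<omega>. d \<omega> $ j * e \<omega> $ j)" for j
    by (rule Bochner_Integration.integrable_bound[OF int])
      (use dj[THEN measurable_from_subalg[OF subalg]] ej in \<open>auto simp: abs_mult intro!: mult_mono component_le_norm_cart\<close>)
  have "integral\<^sup>L M (\<lambda>\<omega>. d \<omega> $ j * e \<omega> $ j) = 0" for j
  proof -
    have "integral\<^sup>L M (\<lambda>\<omega>. d \<omega> $ j * e \<omega> $ j) = integral\<^sup>L M (\<lambda>\<omega>. d \<omega> $ j * real_cond_exp M F (\<lambda>\<omega>. e \<omega> $ j) \<omega>)"
      by (rule real_cond_exp_intg(2)[OF ij dj ej, symmetric])
    also have "\<dots> = integral\<^sup>L M (\<lambda>\<omega>. 0)"
    proof (rule integral_cong_AE)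
      show "AE \<omega> in M. d \<omega> $ j * real_cond_exp M F (\<lambda>\<omega>. e \<omega> $ j) \<omega> = 0"
        using zero by eventually_elim (simp add: vec_cond_exp_def vec_eq_iff)
    qed (use real_cond_exp_intg(1)[OF ij dj ej] in simp_all)
    finally show ?thesis by simp
  qed
  then show "integrable M (\<lambda>\<omega>. e \<omega> \<bullet> d \<omega>)" "integral\<^sup>L M (\<lambda>\<omega>. e \<omega> \<bullet> d \<omega>) = 0"
    using ij by (simp_all add: inner_vec_def mult.commute)
qed

end

section \<open>Stochastic descent with localisation\<close>

context filtered_prob_space
begin

lemma sigma_finite_subalgebra_F: "sigma_finite_subalgebra M (F n)"
proof -
  interpret finite_measure_subalgebra M "F n" by unfold_locales (rule subalg)
  show ?thesis by unfold_locales
qed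

text \<open>The total conditional variance is finite almost surely but may have no finite mean, so
  the process is stopped before this total exceeds \<open>c\<close>. The stopped process obeys
  \<open>bounded_robbins_siegmund\<close>, and almost every path is never stopped for some natural
  \<open>c\<close>.\<close>

lemma stochastic_descent:
  fixes V T :: "nat \<Rightarrow> 'w \<Rightarrow> real" and d e :: "nat \<Rightarrow> 'w \<Rightarrow> real ^ 'n::finite" and \<gamma> :: "nat \<Rightarrow> real"
  assumes V: "\<And>n. V n \<in> borel_measurable (F n)" "\<And>n \<omega>. \<omega> \<in> space M \<Longrightarrow> 0 \<le> V n \<omega> \<and> V n \<omega> \<le> K"
    and T: "\<And>n. T n \<in> borel_measurable (F n)" "\<And>n \<omega>. \<omega> \<in> space M \<Longrightarrow> 0 \<le> T n \<omega> \<and> T n \<omega> \<le> K'"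
    and d: "\<And>n. d n \<in> borel_measurable (F n)" "\<And>n \<omega>. \<omega> \<in> space M \<Longrightarrow> norm (d n \<omega>) \<le> D"
    and e: "\<And>n. e n \<in> borel_measurable M"
    and \<gamma>: "\<And>n. \<gamma> n > 0" "summable (\<lambda>n. (\<gamma> n)\<^sup>2)" and C: "C \<ge> 0"
    and unbiased: "\<And>n. AE \<omega> in M. vec_cond_exp M (F n) (e n) \<omega> = 0"
    and variance: "AE \<omega> in M. (\<Sum>n. ennreal ((\<gamma> n)\<^sup>2) *
         nn_cond_exp M (F n) (\<lambda>\<omega>'. ennreal ((norm (e n \<omega>'))\<^sup>2)) \<omega>) < \<infinity>"
    and descent: "\<And>n \<omega>. \<omega> \<in> space M \<Longrightarrow>
         V (Suc n) \<omega> \<le> V n \<omega> + C * (\<gamma> n)\<^sup>2 - 2 * \<gamma> n * T n \<omega> - 2 * \<gamma> n * (e n \<omega> \<bullet> d n \<omega>) + 2 * (\<gamma> n)\<^sup>2 * (norm (e n \<omega>))\<^sup>2"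
  shows "AE \<omega> in M. convergent (\<lambda>n. V n \<omega>) \<and> summable (\<lambda>n. \<gamma> n * T n \<omega>)"
proof -
  define S where "S n = nn_cond_exp M (F n) (\<lambda>\<omega>'. ennreal ((norm (e n \<omega>'))\<^sup>2))" for n
  define s where "s n \<omega> = enn2real (S n \<omega>)" for n \<omega>
  \<comment> \<open>\<open>J c (Suc n)\<close> is already \<open>F n\<close>-measurable; adding the unused budget \<open>R c - \<Sum>k<n. \<beta> c k\<close>
    to the stopped \<open>V\<close> makes \<open>Y\<close> a nonnegative supermartingale.\<close>
  define J where "J c n = {\<omega> \<in> space M. (\<Sum>k<n. ennreal ((\<gamma> k)\<^sup>2) * S k \<omega>) \<le> ennreal c}" for c :: real and n
  define \<beta> where "\<beta> c n \<omega> = indicat_real (J c (Suc n)) \<omega> * (C * (\<gamma> n)\<^sup>2 + 2 * ((\<gamma> n)\<^sup>2 * s n \<omega>))" for c n \<omega>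
  define U where "U c n \<omega> = indicat_real (J c (Suc n)) \<omega> * (2 * \<gamma> n * T n \<omega>)" for c n \<omega>
  define R where "R c = C * (\<Sum>n. (\<gamma> n)\<^sup>2) + 2 * c" for c
  define Y where "Y c n \<omega> = indicat_real (J c n) \<omega> * V n \<omega> + (R c - (\<Sum>k<n. \<beta> c k \<omega>))" for c n \<omega>
  have s0: "0 \<le> s n \<omega>" for n \<omega> by (simp add: s_def)
  have Smeas: "S k \<in> borel_measurable (F n)" if "k \<le> n" for k n
    unfolding S_def by (rule measurable_mono[OF _ that]) simp
  have J_sets: "J c (Suc n) \<in> sets (F n)" for c n
  proof -
    have "(\<lambda>\<omega>. (\<Sum>k<Suc n. ennreal ((\<gamma> k)\<^sup>2) * S k \<omega>)) \<in> borel_measurable (F n)"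
      using Smeas by (intro borel_measurable_sum borel_measurable_times_ennreal) auto
    from measurable_sets[OF this, of "{..ennreal c}"] show ?thesis
      by (simp add: J_def vimage_def Int_def conj_commute)
  qed
  have sets_mono: "A \<in> sets (F n)" if "A \<in> sets (F m)" "m \<le> n" for A m n
    using subalgebra_mono[OF that(2)] that(1) by (auto simp: subalgebra_def)
  have sets_M: "A \<in> sets M" if "A \<in> sets (F m)" for A m
    using subalg[of m] that by (auto simp: subalgebra_def)
  have J0: "J c 0 = space M" for c by (simp add: J_def)
  have J_anti: "J c n \<subseteq> J c m" if "m \<le> n" for c m n
  proof
    fix \<omega> assume "\<omega> \<in> J c n"
    moreover have "(\<Sum>k<m. ennreal ((\<gamma> k)\<^sup>2) * S k \<omega>) \<le> (\<Sum>k<n. ennreal ((\<gamma> k)\<^sup>2) * S k \<omega>)"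
      using that by (intro sum_mono2) auto
    ultimately show "\<omega> \<in> J c m" unfolding J_def by auto
  qed
  have J_sets': "J c n \<in> sets (F n)" for c n
    using J0 J_sets sets_mono[OF J_sets] sets.top[of "F 0"] by (cases n) auto
  have J_sum: "ennreal (\<Sum>k<n. (\<gamma> k)\<^sup>2 * s k \<omega>) \<le> ennreal c" if \<omega>: "\<omega> \<in> J c n" for c n \<omega>
  proof -
    have le: "(\<Sum>k<n. ennreal ((\<gamma> k)\<^sup>2) * S k \<omega>) \<le> ennreal c" using \<omega> by (simp add: J_def)
    have "ennreal (\<Sum>k<n. (\<gamma> k)\<^sup>2 * s k \<omega>) = (\<Sum>k<n. ennreal ((\<gamma> k)\<^sup>2 * s k \<omega>))"
      using s0 by (intro sum_ennreal[symmetric]) auto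
    also have "\<dots> \<le> (\<Sum>k<n. ennreal ((\<gamma> k)\<^sup>2) * S k \<omega>)"
      unfolding s_def by (intro sum_mono) (auto simp: ennreal_mult' ennreal_enn2real_if intro!: mult_left_mono)
    finally show ?thesis using le by (rule order_trans)
  qed
  have J_bound: "S n \<omega> \<le> ennreal (c / (\<gamma> n)\<^sup>2)" if \<omega>: "\<omega> \<in> J c (Suc n)" and c: "c \<ge> 0" for c n \<omega>
  proof -
    have "ennreal ((\<gamma> n)\<^sup>2) * S n \<omega> \<le> ennreal c"
      using \<omega> by (auto simp: J_def intro: order_trans[rotated])
    then have "ennreal ((\<gamma> n)\<^sup>2) * S n \<omega> / ennreal ((\<gamma> n)\<^sup>2) \<le> ennreal c / ennreal ((\<gamma> n)\<^sup>2)"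
      by (rule divide_right_mono_ennreal)
    also have "ennreal ((\<gamma> n)\<^sup>2) * S n \<omega> / ennreal ((\<gamma> n)\<^sup>2) = S n \<omega>"
      using \<gamma>(1)[of n] by (subst mult.commute, intro ennreal_mult_divide_eq) auto
    finally have "S n \<omega> \<le> ennreal c / ennreal ((\<gamma> n)\<^sup>2)" .
    then show ?thesis using \<gamma>(1)[of n] c by (simp add: divide_ennreal)
  qed
  have \<beta>0: "0 \<le> \<beta> c n \<omega>" for c n \<omega> using s0 C by (simp add: \<beta>_def)
  \<comment> \<open>The step sizes contribute at most C times the sum of their squares. For the
    variances, either the path is still in \<open>J c (Suc n)\<close> and the full partial sum is at
    most \<open>c\<close>, or the new term is zero.\<close>
  have \<beta>_sum: "(\<Sum>k<n. \<beta> c k \<omega>) \<le> R c" if c: "c \<ge> 0" for c n \<omega>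
  proof -
    have "(\<Sum>k<n. indicat_real (J c (Suc k)) \<omega> * ((\<gamma> k)\<^sup>2 * s k \<omega>)) \<le> c"
    proof (induction n)
      case (Suc n)
      show ?case
      proof (cases "\<omega> \<in> J c (Suc n)")
        case True
        have "(\<Sum>k<Suc n. indicat_real (J c (Suc k)) \<omega> * ((\<gamma> k)\<^sup>2 * s k \<omega>)) \<le> (\<Sum>k<Suc n. (\<gamma> k)\<^sup>2 * s k \<omega>)"
          using s0 by (intro sum_mono) (auto simp: indicator_def)
        also have "\<dots> \<le> c" using J_sum[OF True] c by (simp add: ennreal_le_iff)
        finally show ?thesis .
      qed (use Suc in simp)
    qed (use c in simp)
    moreover have "(\<Sum>k<n. indicat_real (J c (Suc k)) \<omega> * (C * (\<gamma> k)\<^sup>2)) \<le> (\<Sum>k<n. C * (\<gamma> k)\<^sup>2)"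
      using C by (intro sum_mono) (auto simp: indicator_def)
    moreover have "(\<Sum>k<n. C * (\<gamma> k)\<^sup>2) \<le> C * (\<Sum>n. (\<gamma> n)\<^sup>2)"
      using C sum_le_suminf[OF \<gamma>(2), of "{..<n}"] by (simp add: sum_distrib_left[symmetric] mult_left_mono)
    moreover have "(\<Sum>k<n. \<beta> c k \<omega>) = (\<Sum>k<n. indicat_real (J c (Suc k)) \<omega> * (C * (\<gamma> k)\<^sup>2))
        + 2 * (\<Sum>k<n. indicat_real (J c (Suc k)) \<omega> * ((\<gamma> k)\<^sup>2 * s k \<omega>))"
      unfolding \<beta>_def by (simp add: sum.distrib sum_distrib_left algebra_simps)
    ultimately show ?thesis unfolding R_def by linarith
  qed
  have \<beta>_meas: "\<beta> c k \<in> borel_measurable (F n)" if "k \<le> n" for c k n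
  proof -
    note sets_mono[OF J_sets that, measurable] Smeas[OF that, measurable]
    show ?thesis unfolding \<beta>_def s_def by measurable
  qed
  have Y_adapted: "Y c n \<in> borel_measurable (F n)" for c n
  proof -
    note J_sets'[measurable] V(1)[measurable]
    have [measurable]: "(\<lambda>\<omega>. \<Sum>k<n. \<beta> c k \<omega>) \<in> borel_measurable (F n)"
      using \<beta>_meas by (intro borel_measurable_sum) auto
    show ?thesis unfolding Y_def by measurable
  qed
  have Y_bounded: "0 \<le> Y c n \<omega> \<and> Y c n \<omega> \<le> K + R c" if "\<omega> \<in> space M" "c \<ge> 0" for c n \<omega>
  proof -
    have "0 \<le> (\<Sum>k<n. \<beta> c k \<omega>)" "(\<Sum>k<n. \<beta> c k \<omega>) \<le> R c"
      using \<beta>0 \<beta>_sum[OF that(2)] by (auto intro: sum_nonneg)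
    then show ?thesis using V(2)[OF that(1), of n] by (auto simp: Y_def indicator_def)
  qed
  have Y_int: "integrable M (Y c n)" if "c \<ge> 0" for c n
    by (rule integrable_bounded_adapted[where Y="Y c" and K="K + R c"]) (use Y_adapted Y_bounded that in auto)
  have U_int: "integrable M (U c n)" for c n
  proof (rule integrable_const_bound[of _ "2 * \<gamma> n * K'"])
    show "AE \<omega> in M. norm (U c n \<omega>) \<le> 2 * \<gamma> n * K'"
      using T(2)[of _ n] \<gamma>(1)[of n] by (intro AE_I2) (auto simp: U_def indicator_def intro: order_trans)
    note sets_M[OF J_sets, measurable] measurable_M[OF T(1), measurable]
    show "U c n \<in> borel_measurable M" unfolding U_def by measurable
  qed
  have U_nonneg: "0 \<le> U c n \<omega>" if "\<omega> \<in> space M" for c n \<omega>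
    using T(2)[OF that, of n] \<gamma>(1)[of n] by (simp add: U_def)
  have drift: "expectation (\<lambda>\<omega>. indicat_real B \<omega> * Y c (Suc n) \<omega>)
      \<le> expectation (\<lambda>\<omega>. indicat_real B \<omega> * (Y c n \<omega> - U c n \<omega>))"
    if B: "B \<in> sets (F n)" and c: "c \<ge> 0" for B c n
  proof -
    interpret Fn: sigma_finite_subalgebra M "F n" by (rule sigma_finite_subalgebra_F)
    \<comment> \<open>This event lies in \<open>F n\<close>, and on it the conditional variance of
      \<open>e n\<close> is at most \<open>c / (\<gamma> n)\<^sup>2\<close>; this makes the error
      terms integrable.\<close>
    let ?B = "B \<inter> J c (Suc n)"
    have B': "?B \<in> sets (F n)" using B J_sets by blast
    note B'[measurable] sets_M[OF B', measurable] sets_M[OF B, measurable] e[measurable] d(1)[measurable]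
    have fin: "emeasure M ?B < \<infinity>" by (simp add: less_top[symmetric])
    have bd: "nn_cond_exp M (F n) (\<lambda>\<omega>. ennreal ((norm (e n \<omega>))\<^sup>2)) \<omega> \<le> ennreal (c / (\<gamma> n)\<^sup>2)" if "\<omega> \<in> ?B" for \<omega>
      using J_bound c that unfolding S_def by blast
    have hm: "(\<lambda>\<omega>. (norm (e n \<omega>))\<^sup>2) \<in> borel_measurable M" by simp
    note cond = B' fin hm _ bd
    let ?e2 = "\<lambda>\<omega>. indicat_real ?B \<omega> * (norm (e n \<omega>))\<^sup>2" and ?s = "\<lambda>\<omega>. indicat_real ?B \<omega> * s n \<omega>"
    have e2: "integrable M ?e2" by (rule Fn.integrable_indicator_mult[OF cond]) auto
    have se: "integrable M ?s" "expectation ?s = expectation ?e2"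
      unfolding s_def S_def
      by (rule Fn.integrable_indicator_mult_cond_exp[OF cond] Fn.integral_indicator_mult_cond_exp[OF cond]; simp)+
    \<comment> \<open>The indicator is absorbed into the factor known at time \<open>n\<close>, so
      that unbiasedness applies to the localised product.\<close>
    let ?d = "\<lambda>\<omega>. indicat_real ?B \<omega> *\<^sub>R d n \<omega>"
    have dm: "?d \<in> borel_measurable (F n)" by measurable
    have "integrable M (\<lambda>\<omega>. norm (?d \<omega>) * norm (e n \<omega>))"
    proof (rule Bochner_Integration.integrable_bound)
      show "integrable M (\<lambda>\<omega>. D * (1 + ?e2 \<omega>))" using e2 by simp
      show "(\<lambda>\<omega>. norm (?d \<omega>) * norm (e n \<omega>)) \<in> borel_measurable M"
        by (rule borel_measurable_times[OF measurable_compose[OF measurable_M[OF dm] borel_measurable_norm]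
              measurable_compose[OF e borel_measurable_norm]])
      show "AE \<omega> in M. norm (norm (?d \<omega>) * norm (e n \<omega>)) \<le> norm (D * (1 + ?e2 \<omega>))"
      proof (intro AE_I2)
        fix \<omega> assume "\<omega> \<in> space M"
        then have D: "norm (d n \<omega>) \<le> D" by (rule d(2))
        then have D0: "0 \<le> D" using norm_ge_zero order_trans by blast
        \<comment> \<open>Completing the square dominates the first moment by the second.\<close>
        have "norm (e n \<omega>) \<le> 1 + (norm (e n \<omega>))\<^sup>2"
          using zero_le_power2[of "norm (e n \<omega>) - 1/2"] by (simp add: power2_eq_square algebra_simps)
        then have "norm (d n \<omega>) * norm (e n \<omega>) \<le> D * (1 + (norm (e n \<omega>))\<^sup>2)"
          using D D0 by (intro mult_mono) auto
        then show "norm (norm (?d \<omega>) * norm (e n \<omega>)) \<le> norm (D * (1 + ?e2 \<omega>))"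
          using D0 by (auto simp: indicator_def abs_mult)
      qed
    qed
    note ed = Fn.integral_inner_eq_0_if_vec_cond_exp_eq_0[OF dm e this unbiased]
    have Yint: "integrable M (\<lambda>\<omega>. indicat_real B \<omega> * Y c m \<omega>)" for m
      using integrable_real_mult_indicator[OF sets_M[OF B] Y_int[OF c]]
      by (simp add: mult.commute)
    have YU: "integrable M (\<lambda>\<omega>. indicat_real B \<omega> * (Y c n \<omega> - U c n \<omega>))"
      using Yint[of n] integrable_real_mult_indicator[OF sets_M[OF B] U_int]
      by (simp add: right_diff_distrib mult.commute)
    \<comment> \<open>Both correction terms on the right have mean zero: the first by unbiasedness,
      the second because \<open>s n\<close> is the conditional expectation of the squared
      error.\<close>
    have "expectation (\<lambda>\<omega>. indicat_real B \<omega> * Y c (Suc n) \<omega>)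
        \<le> expectation (\<lambda>\<omega>. indicat_real B \<omega> * (Y c n \<omega> - U c n \<omega>) - 2 * \<gamma> n * (e n \<omega> \<bullet> ?d \<omega>) + 2 * (\<gamma> n)\<^sup>2 * (?e2 \<omega> - ?s \<omega>))"
    proof (rule integral_mono)
      show "integrable M (\<lambda>\<omega>. indicat_real B \<omega> * Y c (Suc n) \<omega>)" by (rule Yint)
      show "integrable M (\<lambda>\<omega>. indicat_real B \<omega> * (Y c n \<omega> - U c n \<omega>) - 2 * \<gamma> n * (e n \<omega> \<bullet> ?d \<omega>) + 2 * (\<gamma> n)\<^sup>2 * (?e2 \<omega> - ?s \<omega>))"
        by (intro Bochner_Integration.integrable_add Bochner_Integration.integrable_diff integrable_mult_right YU ed(1) e2 se(1))
      fix \<omega> assume \<omega>: "\<omega> \<in> space M"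
      let ?i = "indicat_real (J c (Suc n)) \<omega>" and ?b = "indicat_real B \<omega>"
      have "?i * V (Suc n) \<omega> \<le> ?i * (V n \<omega> + C * (\<gamma> n)\<^sup>2 - 2 * \<gamma> n * T n \<omega> - 2 * \<gamma> n * (e n \<omega> \<bullet> d n \<omega>) + 2 * (\<gamma> n)\<^sup>2 * (norm (e n \<omega>))\<^sup>2)"
        using descent[OF \<omega>] by (intro mult_left_mono) auto
      \<comment> \<open>Stopping only lowers the process, as \<open>V\<close> is nonnegative and the
        sets \<open>J c n\<close> decrease.\<close>
      moreover have "?i * V n \<omega> \<le> indicat_real (J c n) \<omega> * V n \<omega>"
        using J_anti[of n "Suc n" c] V(2)[OF \<omega>, of n] by (auto simp: indicator_def)
      ultimately have "Y c (Suc n) \<omega> \<le> Y c n \<omega> - U c n \<omega> - 2 * \<gamma> n * (?i * (e n \<omega> \<bullet> d n \<omega>))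
          + 2 * (\<gamma> n)\<^sup>2 * (?i * (norm (e n \<omega>))\<^sup>2 - ?i * s n \<omega>)"
        unfolding Y_def U_def \<beta>_def by (simp add: algebra_simps)
      then have "?b * Y c (Suc n) \<omega> \<le> ?b * (Y c n \<omega> - U c n \<omega> - 2 * \<gamma> n * (?i * (e n \<omega> \<bullet> d n \<omega>))
          + 2 * (\<gamma> n)\<^sup>2 * (?i * (norm (e n \<omega>))\<^sup>2 - ?i * s n \<omega>))"
        by (intro mult_left_mono) auto
      then show "?b * Y c (Suc n) \<omega> \<le> ?b * (Y c n \<omega> - U c n \<omega>) - 2 * \<gamma> n * (e n \<omega> \<bullet> ?d \<omega>) + 2 * (\<gamma> n)\<^sup>2 * (?e2 \<omega> - ?s \<omega>)"
        by (simp add: indicator_inter_arith algebra_simps)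
    qed
    also have "\<dots> = expectation (\<lambda>\<omega>. indicat_real B \<omega> * (Y c n \<omega> - U c n \<omega>))"
      using YU ed e2 se by simp
    finally show ?thesis .
  qed
  have conv: "AE \<omega> in M. convergent (\<lambda>n. Y c n \<omega>) \<and> summable (\<lambda>n. U c n \<omega>)" if c: "c \<ge> 0" for c
    using bounded_robbins_siegmund[where Y="Y c" and U="U c" and K="K + R c"] Y_adapted Y_bounded U_int U_nonneg drift c
    by (intro AE_conjI) auto
  have "AE \<omega> in M. \<forall>m::nat. convergent (\<lambda>n. Y (real m) n \<omega>) \<and> summable (\<lambda>n. U (real m) n \<omega>)"
    unfolding AE_all_countable using conv by simp
  with variance AE_space show ?thesis
  proof eventually_elim
    case (elim \<omega>)
    \<comment> \<open>A level above the total variance of this path: at level \<open>m\<close> the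
      path is never stopped, and \<open>V\<close> differs from \<open>Y\<close> by a constant and a
      convergent series.\<close>
    obtain m :: nat where "(\<Sum>n. ennreal ((\<gamma> n)\<^sup>2) * S n \<omega>) < of_nat m"
      using elim(1) ennreal_Ex_less_of_nat unfolding S_def infinity_ennreal_def by blast
    then have m: "(\<Sum>n. ennreal ((\<gamma> n)\<^sup>2) * S n \<omega>) \<le> ennreal (real m)" by (simp add: ennreal_of_nat_eq_real_of_nat less_imp_le)
    have inJ: "\<omega> \<in> J (real m) n" for n
      using elim(2) order_trans[OF sum_le_suminf m] by (simp add: J_def)
    have "summable (\<lambda>k. \<beta> (real m) k \<omega>)"
      using \<beta>0 \<beta>_sum by (intro summableI_nonneg_bounded[where x="R (real m)"]) auto
    then have "convergent (\<lambda>n. \<Sum>k<n. \<beta> (real m) k \<omega>)" by (simp add: summable_iff_convergent)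
    moreover have "V n \<omega> = Y (real m) n \<omega> - R (real m) + (\<Sum>k<n. \<beta> (real m) k \<omega>)" for n
      using inJ by (simp add: Y_def)
    ultimately have "convergent (\<lambda>n. V n \<omega>)"
      using elim by (auto intro!: convergent_add convergent_diff convergent_const)
    moreover have U_eq: "U (real m) n \<omega> = 2 * (\<gamma> n * T n \<omega>)" for n
      using inJ by (simp add: U_def)
    have "summable (\<lambda>n. U (real m) n \<omega>)" using elim(3) by blast
    then have "summable (\<lambda>n. 2 * (\<gamma> n * T n \<omega>))" by (simp only: U_eq)
    then have "summable (\<lambda>n. \<gamma> n * T n \<omega>)" by (rule summable_mult_D) simp
    ultimately show ?case by simp
  qed
qed

end

section \<open>From summable weighted gaps to convergence\<close>

text \<open>If the squared distances tended to a positive limit, the sequence would eventually stay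
  in a compact set avoiding \<open>a\<close>. There \<theta> has a positive minimum, which would
  force the divergent step sizes to be summable.\<close>

lemma LIMSEQ_if_weighted_gap_summable:
  fixes x :: "nat \<Rightarrow> 'a::real_normed_vector" and \<theta> :: "'a \<Rightarrow> real"
  assumes P: "compact P" "\<And>n. x n \<in> P"
    and \<theta>: "continuous_on P \<theta>" "\<And>z. \<lbrakk>z \<in> P; z \<noteq> a\<rbrakk> \<Longrightarrow> 0 < \<theta> z"
    and \<gamma>: "\<And>n. 0 < \<gamma> n" "filterlim (\<lambda>n. \<Sum>k<n. \<gamma> k) at_top sequentially"
    and summ: "summable (\<lambda>n. \<gamma> n * \<theta> (x n))"
    and conv: "convergent (\<lambda>n. (norm (x n - a))\<^sup>2)"
  shows "x \<longlonglongrightarrow> a"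
proof -
  obtain v where v: "(\<lambda>n. (norm (x n - a))\<^sup>2) \<longlonglongrightarrow> v" using conv by (auto simp: convergent_def)
  have "0 \<le> v" using v by (rule LIMSEQ_le_const) auto
  have "v = 0"
  proof (rule ccontr)
    assume "v \<noteq> 0"
    with \<open>0 \<le> v\<close> have "v > 0" by simp
    \<comment> \<open>Half the limit leaves room for the tail of the sequence and still keeps
      \<open>a\<close> out.\<close>
    let ?Q = "P \<inter> {z. v / 2 \<le> (norm (z - a))\<^sup>2}"
    have ev: "\<forall>\<^sub>F n in sequentially. x n \<in> ?Q"
      using order_tendstoD(1)[OF v, of "v / 2"] \<open>v > 0\<close> P(2) by (auto elim!: eventually_mono)
    then have "?Q \<noteq> {}" by (auto simp: eventually_sequentially)
    have "closed {z. v / 2 \<le> (norm (z - a))\<^sup>2}" by (intro closed_Collect_le continuous_intros)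
    then have "compact ?Q" using P(1) by (rule compact_Int_closed[rotated])
    then obtain q where q: "q \<in> ?Q" "\<And>z. z \<in> ?Q \<Longrightarrow> \<theta> q \<le> \<theta> z"
      using continuous_attains_inf[of ?Q \<theta>] \<open>?Q \<noteq> {}\<close> continuous_on_subset[OF \<theta>(1), of ?Q] by blast
    have pos: "0 < \<theta> q" using q \<open>v > 0\<close> by (intro \<theta>(2)) auto
    have "\<forall>\<^sub>F n in sequentially. norm (\<gamma> n * \<theta> q) \<le> \<gamma> n * \<theta> (x n)"
      using ev by eventually_elim (use q pos \<gamma>(1) in \<open>simp add: abs_mult less_imp_le\<close>)
    then have "summable (\<lambda>n. \<gamma> n * \<theta> q)" by (rule summable_comparison_test_ev[OF _ summ])
    then have "summable \<gamma>" using pos summable_mult_D[of "\<theta> q" \<gamma>] by (simp add: mult.commute)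
    then have "(\<lambda>n. \<Sum>k<n. \<gamma> k) \<longlonglongrightarrow> suminf \<gamma>" by (rule summable_LIMSEQ)
    then show False using \<gamma>(2) not_tendsto_and_filterlim_at_infinity[of sequentially "\<lambda>n. \<Sum>k<n. \<gamma> k"]
      filterlim_at_top_imp_at_infinity by fastforce
  qed
  with v have "(\<lambda>n. sqrt ((norm (x n - a))\<^sup>2)) \<longlonglongrightarrow> sqrt 0" by (intro tendsto_real_sqrt) simp
  then have "(\<lambda>n. norm (x n - a)) \<longlonglongrightarrow> 0" by simp
  then show ?thesis by (simp add: tendsto_norm_zero_iff LIM_zero_iff)
qed

section \<open>The history filtration\<close>

lemma (in prob_space) filtered_prob_space_history:
  assumes x0: "x0 \<in> borel_measurable M" and \<Xi>: "\<And>k. \<Xi> k \<in> borel_measurable M"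
  shows "filtered_prob_space M (history M x0 \<Xi>)"
proof
  define A where "A k = {x0 -` A \<inter> space M | A. A \<in> sets borel} \<union>
      {\<Xi> m -` A \<inter> space M | m A. m < k \<and> A \<in> sets borel}" for k
  have A: "A k \<subseteq> sets M" for k
    using measurable_sets[OF x0] measurable_sets[OF \<Xi>] by (auto simp: A_def)
  then have Pow: "A k \<subseteq> Pow (space M)" for k using sets.space_closed by blast
  have sets_H: "sets (history M x0 \<Xi> k) = sigma_sets (space M) (A k)" for k
    unfolding history_def A_def[symmetric] by (rule sets_measure_of[OF Pow])
  fix n
  have "space (history M x0 \<Xi> n) = space M"
    unfolding history_def A_def[symmetric] by (rule space_measure_of[OF Pow])
  then show "subalgebra M (history M x0 \<Xi> n)"
    unfolding subalgebra_def sets_H using sets.sigma_sets_subset[OF A] by blast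
  have "A n \<subseteq> A (Suc n)" unfolding A_def using less_Suc_eq by blast
  then show "sets (history M x0 \<Xi> n) \<subseteq> sets (history M x0 \<Xi> (Suc n))"
    unfolding sets_H by (rule sigma_sets_subseteq)
qed

section \<open>Convergence of the iterates\<close>

theorem theorem2:
  fixes M :: "'w measure"
    and own :: "'n::finite \<Rightarrow> 'i::finite"
    and \<xi> :: "'w \<Rightarrow> real ^ 'd::finite ^ 'i"
    and \<Omega> :: "'i \<Rightarrow> (real ^ 'n) set"
    and f :: "'i \<Rightarrow> real ^ 'n \<Rightarrow> real ^ 'd \<Rightarrow> real"
    and \<l> :: "'i \<Rightarrow> real ^ 'n \<Rightarrow> real ^ 'd \<Rightarrow> real"
    and g :: "'i \<Rightarrow> real ^ 'n \<Rightarrow> ereal"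
    and \<gamma> :: "nat \<Rightarrow> real"
    and \<Xi> :: "nat \<Rightarrow> 'w \<Rightarrow> real ^ 'd ^ 'i"
    and x :: "nat \<Rightarrow> 'w \<Rightarrow> real ^ 'n"
    and xs :: "real ^ 'n"
    and L :: real
  defines "F \<equiv> pseudogradient M own \<xi> f"
    and "\<epsilon> \<equiv> stochastic_error M own \<xi> f \<Xi> x"
    and "H \<equiv> history M (x 0) \<Xi>"
  assumes game: "stochastic_game M own \<xi> \<Omega> f \<l> g"
    and F_continuous: "continuous_on (profiles own \<Omega>) F"
    and samples: "iid_samples M \<xi> \<Xi>"
    and step_pos: "\<And>k. \<gamma> k > 0"
    and iterates: "forward_backward_iterates M own \<Omega> f g \<gamma> \<Xi> x"
    and initial_measurable: "x 0 \<in> borel_measurable M"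
    and adapted: "\<And>k. x k \<in> borel_measurable (H k)"
    and error_measurable: "\<And>k. \<epsilon> k \<in> borel_measurable M"
    and solution: "xs \<in> SOL own \<Omega> F g"
    and unbiased: "\<And>k. AE \<omega> in M. vec_cond_exp M (H k) (\<epsilon> k) \<omega> = 0"
    and steps_diverge: "filterlim (\<lambda>n. \<Sum>k<n. \<gamma> k) at_top sequentially"
    and steps_square_summable: "summable (\<lambda>k. (\<gamma> k)\<^sup>2)"
    and error_variance:
      "AE \<omega> in M. (\<Sum>k. ennreal ((\<gamma> k)\<^sup>2) *
         nn_cond_exp M (H k) (\<lambda>\<omega>'. ennreal ((norm (\<epsilon> k \<omega>'))\<^sup>2)) \<omega>) < \<infinity>"
    and L_pos: "L > 0"
    and restricted_lipschitz:
      "\<And>z. z \<in> profiles own \<Omega> \<Longrightarrow> norm (F z - F xs) \<le> L * norm (z - xs)"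
    and restricted_strictly_monotone:
      "\<And>z. \<lbrakk>z \<in> profiles own \<Omega>; z \<noteq> xs\<rbrakk> \<Longrightarrow> (F z - F xs) \<bullet> (z - xs) > 0"
  shows "\<exists>z \<in> SOL own \<Omega> F g. AE \<omega> in M. (\<lambda>k. x k \<omega>) \<longlonglongrightarrow> z"
\<comment> \<open>The limit is the given solution \<open>xs\<close> itself, the same for almost
  every \<omega>.\<close>
proof (rule bexI[OF _ solution])
  interpret stochastic_game M own \<xi> \<Omega> f \<l> g by (rule game)
  let ?P = "profiles own \<Omega>"
  have "indep_vars (\<lambda>_. borel) \<Xi> UNIV" using samples by (simp add: iid_samples_def)
  then have "\<Xi> k \<in> borel_measurable M" for k by (simp add: indep_vars_def)
  then interpret H: filtered_prob_space M H
    unfolding H_def by (intro filtered_prob_space_history initial_measurable)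
  have xs: "xs \<in> ?P" using solution by (simp add: SOL_def)
  \<comment> \<open>By the definition of the stochastic error, the sampled gradient is
    \<open>F\<close> plus \<epsilon>.\<close>
  have step: "block own i (x (Suc k) \<omega>) = prox (agent_space own i) (\<lambda>u. ereal (\<gamma> k) * g i u)
      (block own i (x k \<omega>) - \<gamma> k *\<^sub>R block own i (F (x k \<omega>) + \<epsilon> k \<omega>))" if "\<omega> \<in> space M" for i k \<omega>
    using iterates that by (simp add: forward_backward_iterates_def F_def \<epsilon>_def stochastic_error_def)
  have x: "x k \<omega> \<in> ?P" if \<omega>: "\<omega> \<in> space M" for k \<omega>
  proof (cases k)
    case 0
    then show ?thesis using iterates \<omega> by (simp add: forward_backward_iterates_def profiles_def)
  next
    case (Suc m)
    show ?thesis unfolding Suc by (rule forward_backward_step_in_profiles[OF solution step_pos step[OF \<omega>]])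
  qed
  define \<theta> where "\<theta> z = (F z - F xs) \<bullet> (z - xs)" for z
  have \<theta>_cont: "continuous_on ?P \<theta>" unfolding \<theta>_def by (intro continuous_intros F_continuous)
  have \<theta>_pos: "0 < \<theta> z" if "z \<in> ?P" "z \<noteq> xs" for z
    unfolding \<theta>_def by (rule restricted_strictly_monotone[OF that])
  have \<theta>_nonneg: "0 \<le> \<theta> z" if "z \<in> ?P" for z
    using \<theta>_pos[OF that] by (cases "z = xs") (auto simp: \<theta>_def)
  obtain K' where K': "\<And>z. z \<in> ?P \<Longrightarrow> \<theta> z \<le> K'"
    using continuous_attains_sup[OF compact_profiles _ \<theta>_cont] xs by blast
  obtain D where D: "\<And>z. z \<in> ?P \<Longrightarrow> norm (z - xs) \<le> D"
    using compact_imp_bounded[OF compact_profiles] unfolding bounded_any_center[of _ xs]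
    by (auto simp: dist_norm norm_minus_commute)
  have V_le: "(norm (z - xs))\<^sup>2 \<le> D\<^sup>2" if "z \<in> ?P" for z
    using D[OF that] by (intro power_mono) auto
  \<comment> \<open>Continuity of \<theta> is known on the profiles only, so the composition goes
    through the restricted Borel space.\<close>
  have \<theta>_meas: "(\<lambda>\<omega>. \<theta> (x k \<omega>)) \<in> borel_measurable (H k)" for k
  proof (rule measurable_compose[of "x k" _ "restrict_space borel ?P"])
    show "x k \<in> measurable (H k) (restrict_space borel ?P)"
      using x by (intro measurable_restrict_space2 adapted) auto
    show "\<theta> \<in> borel_measurable (restrict_space borel ?P)"
      by (rule borel_measurable_continuous_on_restrict[OF \<theta>_cont])
  qed
  have "AE \<omega> in M. convergent (\<lambda>k. (norm (x k \<omega> - xs))\<^sup>2) \<and> summable (\<lambda>k. \<gamma> k * \<theta> (x k \<omega>))"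
  proof (rule H.stochastic_descent[where V="\<lambda>k \<omega>. (norm (x k \<omega> - xs))\<^sup>2" and T="\<lambda>k \<omega>. \<theta> (x k \<omega>)"
        and d="\<lambda>k \<omega>. x k \<omega> - xs" and C="2 * L\<^sup>2 * D\<^sup>2" and D=D and K="D\<^sup>2" and K'=K'])
    fix n \<omega> assume \<omega>: "\<omega> \<in> space M"
    let ?V = "\<lambda>n. (norm (x n \<omega> - xs))\<^sup>2"
    have "norm (x (Suc n) \<omega> - xs) \<le> norm (x n \<omega> - xs - \<gamma> n *\<^sub>R ((F (x n \<omega>) - F xs) + \<epsilon> n \<omega>))"
      using forward_backward_step_le[OF solution step_pos step[OF \<omega>]] by (simp add: algebra_simps)
    then have "?V (Suc n) \<le> (norm (x n \<omega> - xs - \<gamma> n *\<^sub>R ((F (x n \<omega>) - F xs) + \<epsilon> n \<omega>)))\<^sup>2"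
      by (rule power_mono) simp
    also have "\<dots> \<le> ?V n + 2 * (\<gamma> n)\<^sup>2 * L\<^sup>2 * ?V n - 2 * \<gamma> n * \<theta> (x n \<omega>)
        - 2 * \<gamma> n * (\<epsilon> n \<omega> \<bullet> (x n \<omega> - xs)) + 2 * (\<gamma> n)\<^sup>2 * (norm (\<epsilon> n \<omega>))\<^sup>2"
      unfolding \<theta>_def by (rule norm_diff_scaleR_le[OF restricted_lipschitz[OF x[OF \<omega>]]])
    \<comment> \<open>Boundedness of the profiles turns the multiplicative growth of
      \<open>V\<close> into an additive summable term; this is the constant \<open>C\<close> chosen
      above.\<close>
    also have "2 * (\<gamma> n)\<^sup>2 * L\<^sup>2 * ?V n \<le> 2 * (\<gamma> n)\<^sup>2 * L\<^sup>2 * D\<^sup>2"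
      using V_le[OF x[OF \<omega>]] by (intro mult_left_mono) auto
    finally show "?V (Suc n) \<le> ?V n + 2 * L\<^sup>2 * D\<^sup>2 * (\<gamma> n)\<^sup>2 - 2 * \<gamma> n * \<theta> (x n \<omega>)
        - 2 * \<gamma> n * (\<epsilon> n \<omega> \<bullet> (x n \<omega> - xs)) + 2 * (\<gamma> n)\<^sup>2 * (norm (\<epsilon> n \<omega>))\<^sup>2"
      by (simp add: algebra_simps)
  next
    fix n
    show "(\<lambda>\<omega>. (norm (x n \<omega> - xs))\<^sup>2) \<in> borel_measurable (H n)"
      using adapted[of n] by (intro borel_measurable_power measurable_compose[OF _ borel_measurable_norm] borel_measurable_diff) auto
    show "(\<lambda>\<omega>. x n \<omega> - xs) \<in> borel_measurable (H n)"
      using adapted[of n] by (intro borel_measurable_diff) auto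
  qed (use x V_le K' D \<theta>_nonneg \<theta>_meas error_measurable step_pos steps_square_summable unbiased error_variance in auto)
  with AE_space show "AE \<omega> in M. (\<lambda>k. x k \<omega>) \<longlonglongrightarrow> xs"
  proof eventually_elim
    case (elim \<omega>)
    then show ?case
      by (intro LIMSEQ_if_weighted_gap_summable[OF compact_profiles x \<theta>_cont \<theta>_pos step_pos steps_diverge]) auto
  qed
qed

end
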